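(* Let $V=\mathbb R^2$ and let $F_2$ be the free group of rank $2$. If $\rho:F_2\to\mathrm{PGL}(V)$ is primitive stable, then there is a pair of generators $(\gamma_1,\gamma_2)$ of $F_2$ such that, for the map $R_3:A_3\to F_2$ defined by $(\gamma_1,\gamma_2)$ on the vertex set $A_3$ of the directed graph $\Lambda_3$, the representation $\rho$ is $(R_3,\Lambda_3)$-weakly positive.
   Context: The graph $\Lambda_3$ and the map $R_3$. A finite directed graph $(A,B)$ consists of a finite vertex set $A$ and a set $B\subset A\times A$ of directed edges. $\mathsf K(v,w)$ is the directed graph with vertex set $\{v,w\}$ and edge set $\{v,w\}\times\{v,w\}$ (loops included). $\Lambda_3=(A_3,B_3)$ is the disjoint union of $\mathsf K(v_i,w_i)$ and $\mathsf K(v_i',w_i')$ for $i=1,2,3$ (12 distinct vertices). With $\gamma_3:=\gamma_2^{-1}\gamma_1^{-1}$, the map $R_3:A_3\to F_2$ defined by $(\gamma_1,\gamma_2)$ is given by $(R_3(v_1),R_3(w_1))=(\gamma_1^{-1},\gamma_2)$, $(R_3(v_2),R_3(w_2))=(\gamma_2^{-1},\gamma_3)$, $(R_3(v_3),R_3(w_3))=(\gamma_3^{-1},\gamma_1)$, and $R_3(v_i')=R_3(v_i)^{-1}$, $R_3(w_i')=R_3(w_i)^{-1}$ for $i=1,2,3$. Weak positivity for $V=\mathbb R^2$. Here the flag space $\mathcal F(V)$ is the projective line $\mathbb P(\mathbb R^2)$, and a tuple $(F_1,\dots,F_l)$, $l\ge3$, is positive if and only if its entries are pairwise distinct and occur in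 this order in one of the two natural cyclic orders on $\mathbb P(\mathbb R^2)$. For a positive triple $(F,H,K)$, $\mathfrak U(F,H,K)=\{G:(F,G,H,K)\text{ is positive}\}$, i.e. the open interval with endpoints $F,H$ not containing $K$. For a finite directed graph $\Lambda=(A,B)$ and $f:A\to\mathrm{PGL}(V)$, a compatible system of forward domains for $(f,\Lambda)$ assigns to each $a\in A$ a positive triple $(F_a,H_a,K_a)$ such that for every $(a_1,a_2)\in B$: (i) $f(a_1)\cdot\mathfrak U(F_{a_2},H_{a_2},K_{a_2})\subset\mathfrak U(F_{a_1},H_{a_1},K_{a_1})$; and (ii) at least one of $(F_{a_1},f(a_1)\cdot F_{a_2},f(a_1)\cdot H_{a_2},H_{a_1})$ and $(F_{a_1},f(a_1)\cdot H_{a_2},f(a_1)\cdot F_{a_2},H_{a_1})$ is positive. $f$ is $\Lambda$-admissible if such a system exists. For a map $R:A\to F_2$, $\rho$ is $(R,\Lambda)$-weakly positive if $\rho\circ R$ is $\Lambda$-admissible. Primitive stable. Fix an inner product on $V=\mathbb R^2$. For $g\in\mathrm{PGL}(V)$ let $\bar g$ be a representative with $|\det\bar g|=1$ and singular values $\mu_1(\bar g)\ge\mu_2(\bar g)$, and put $\alpha(\mu(g))=\log\mu_1(\bar g)-\log\mu_2(\bar g)$. An element of $F_2$ is primitive if it belongs to a two-element generating set of $F_2$. With a word metric on $F_2$, an axis of a non-identity $\gamma$ is a (bi-infinite) geodesic in $F_2$ invariant under $\gamma$; a primitive geodesic ray is a geodesic ray lying in an axis of a primitive element; it is rooted if it starts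 at $\mathrm{id}$. $\rho:F_2\to\mathrm{PGL}(V)$ is primitive stable if for some (equivalently any) word metric on $F_2$ there are $\kappa,\kappa'>0$ such that $\alpha(\mu(\rho(\eta_i)))\ge\kappa i-\kappa'$ for all rooted primitive geodesic rays $(\eta_i)_{i=0}^\infty$ and all $i\ge0$. *)

theory Defs
  imports "HOL-Analysis.Analysis" "HOL-Algebra.Algebra"
begin

section \<open>The free group of rank 2\<close>

datatype basis = Gen_a | Gen_b

text \<open>The letter \<open>(x, False)\<close> stands for \<open>x\<close> and \<open>(x, True)\<close> for its inverse.\<close>

type_synonym letter = "basis \<times> bool"

definition letter_inv :: "letter \<Rightarrow> letter" where
  "letter_inv l = (fst l, \<not> snd l)"

definition reduced :: "letter list \<Rightarrow> bool" where
  "reduced w \<longleftrightarrow> (\<forall>i. Suc i < length w \<longrightarrow> w ! Suc i \<noteq> letter_inv (w ! i))"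

fun push :: "letter \<Rightarrow> letter list \<Rightarrow> letter list" where
  "push l [] = [l]"
| "push l (m # w) = (if m = letter_inv l then w else l # m # w)"

definition F2 :: "letter list monoid" where
  "F2 = \<lparr>carrier = {w. reduced w}, mult = (\<lambda>u v. foldr push u v), one = []\<rparr>"

lemma letter_inv_inv [simp]: "letter_inv (letter_inv l) = l"
  by (simp add: letter_inv_def)

lemma letter_inv_neq [simp]: "letter_inv l \<noteq> l" "l \<noteq> letter_inv l"
  by (auto simp: letter_inv_def prod_eq_iff)

lemma reduced_Nil [simp]: "reduced []"
  and reduced_single [simp]: "reduced [l]"
  by (simp_all add: reduced_def)

lemma reduced_Cons2 [simp]:
  "reduced (l # m # w) \<longleftrightarrow> m \<noteq> letter_inv l \<and> reduced (m # w)"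
  unfolding reduced_def by (auto simp: nth_Cons split: nat.splits)

lemma reduced_ConsD: "reduced (l # w) \<Longrightarrow> reduced w"
  by (cases w) auto

lemma reduced_push: "reduced w \<Longrightarrow> reduced (push l w)"
  by (cases w) (auto dest: reduced_ConsD)

lemma push_push_inv: "reduced w \<Longrightarrow> push l (push (letter_inv l) w) = w"
  by (cases w; cases "tl w") auto

lemma reduced_foldr_push: "reduced v \<Longrightarrow> reduced (foldr push u v)"
  by (induction u) (auto intro: reduced_push)

lemma foldr_push_push:
  assumes "reduced v"
  shows "foldr push (push l u) v = push l (foldr push u v)"
proof (cases u)
  case (Cons m u')
  then show ?thesis
    using push_push_inv[OF reduced_foldr_push[OF assms], of l u'] by auto
qed simp

lemma foldr_push_assoc:
  assumes "reduced v"
  shows "foldr push (foldr push t u) v = foldr push t (foldr push u v)"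
  using assms by (induction t) (simp_all add: foldr_push_push)

lemma foldr_push_Nil: "reduced u \<Longrightarrow> foldr push u [] = u"
proof (induction u)
  case (Cons l u)
  then show ?case by (cases u) (auto dest: reduced_ConsD)
qed simp

lemma foldr_push_left_inverse:
  "foldr push (map letter_inv (rev u)) (foldr push u v) = v" if "reduced v"
proof (induction u)
  case (Cons l u)
  then show ?case
    using push_push_inv[OF reduced_foldr_push[OF that], of "letter_inv l" u] by simp
qed simp

lemma group_F2: "group F2"
proof (rule groupI)
  fix u assume "u \<in> carrier F2"
  then have u: "reduced u" by (simp add: F2_def)
  let ?v = "foldr push (map letter_inv (rev u)) []"
  have "foldr push ?v u = []"
    using foldr_push_left_inverse[of "[]" u] u
    by (simp only: foldr_push_assoc foldr.simps id_apply foldr_push_Nil reduced_Nil)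
  moreover have "reduced ?v" by (simp add: reduced_foldr_push)
  ultimately show "\<exists>v\<in>carrier F2. v \<otimes>\<^bsub>F2\<^esub> u = \<one>\<^bsub>F2\<^esub>"
    by (auto simp: F2_def)
qed (auto simp: F2_def reduced_foldr_push foldr_push_assoc)

lemma F2_universal_property:
  fixes G (structure) and \<phi> :: "basis \<Rightarrow> 'g"
  assumes "group G" and \<phi>: "\<And>x. \<phi> x \<in> carrier G"
  shows "\<exists>f \<in> hom F2 G. \<forall>x. f [(x, False)] = \<phi> x"
proof -
  interpret group G by fact
  define ev where "ev l = (if snd l then inv (\<phi> (fst l)) else \<phi> (fst l))" for l :: letter
  define f where "f w = foldr (\<lambda>l g. ev l \<otimes> g) w \<one>" for w
  have ev [simp]: "ev l \<in> carrier G" for l by (simp add: ev_def \<phi>)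
  have ev_inv: "ev l \<otimes> ev (letter_inv l) = \<one>" for l
    by (simp add: ev_def letter_inv_def \<phi>)
  have f [simp]: "f w \<in> carrier G" for w by (induction w) (auto simp: f_def)
  have f_Cons: "f (l # w) = ev l \<otimes> f w" for l w by (simp add: f_def)
  have f_push: "f (push l w) = ev l \<otimes> f w" for l w
    by (cases w) (auto simp: f_Cons m_assoc[symmetric] ev_inv)
  have "f (foldr push u v) = f u \<otimes> f v" for u v
    by (induction u) (auto simp: f_push f_Cons m_assoc, simp add: f_def)
  then have "f \<in> hom F2 G" by (auto simp: hom_def F2_def)
  moreover have "f [(x, False)] = \<phi> x" for x by (simp add: f_def ev_def \<phi>)
  ultimately show ?thesis by blast
qed

section \<open>The group $\mathrm{PGL}(\mathbb{R}^2)$ and its action on lines\<close>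

definition GL2 :: "(real^2^2) monoid" where
  "GL2 = \<lparr>carrier = {A. invertible A}, mult = (**), one = mat 1\<rparr>"

definition scalars :: "(real^2^2) set" where
  "scalars = {c *\<^sub>R mat 1 | c. c \<noteq> 0}"

definition PGL2 :: "(real^2^2) set monoid" where
  "PGL2 = GL2 Mod scalars"

lemma group_GL2: "group GL2"
proof (rule groupI)
  fix A assume "A \<in> carrier GL2"
  then obtain B :: "real^2^2" where "A ** B = mat 1" "B ** A = mat 1"
    by (auto simp: GL2_def invertible_def)
  then show "\<exists>B\<in>carrier GL2. B \<otimes>\<^bsub>GL2\<^esub> A = \<one>\<^bsub>GL2\<^esub>"
    by (auto simp: GL2_def invertible_def)
qed (auto simp: GL2_def matrix_mul_assoc invertible_mult invertible_def[of "mat 1"])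

lemma normal_scalars: "scalars \<lhd> GL2"
proof -
  interpret group GL2 by (rule group_GL2)
  have mult: "(c *\<^sub>R mat 1) ** A = c *\<^sub>R A" "A ** (c *\<^sub>R mat 1) = c *\<^sub>R A"
    for c and A :: "real^2^2"
    by (simp_all add: matrix_scalar_ac scalar_matrix_assoc[symmetric])
  have inv: "invertible (c *\<^sub>R mat 1 :: real^2^2)" if "c \<noteq> 0" for c
    unfolding invertible_def using that
    by (intro exI[of _ "(1/c) *\<^sub>R mat 1"]) (simp add: mult)
  have m_inv: "inv\<^bsub>GL2\<^esub> (c *\<^sub>R mat 1) = (1/c) *\<^sub>R mat 1" if "c \<noteq> 0" for c
    using that by (intro inv_equality) (simp_all add: GL2_def inv mult)
  have "subgroup scalars GL2"
  proof (rule subgroupI)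
    show "scalars \<subseteq> carrier GL2" by (auto simp: scalars_def GL2_def inv)
    show "scalars \<noteq> {}" by (auto simp: scalars_def intro: exI[of _ "1::real"])
  next
    fix A assume "A \<in> scalars"
    then obtain c where "c \<noteq> 0" "A = c *\<^sub>R mat 1" by (auto simp: scalars_def)
    then show "inv\<^bsub>GL2\<^esub> A \<in> scalars"
      unfolding scalars_def using m_inv by (auto intro!: exI[of _ "1/c"])
  next
    fix A B assume "A \<in> scalars" "B \<in> scalars"
    then obtain c d where "c \<noteq> 0" "A = c *\<^sub>R mat 1" "d \<noteq> 0" "B = d *\<^sub>R mat 1"
      by (auto simp: scalars_def)
    then show "A \<otimes>\<^bsub>GL2\<^esub> B \<in> scalars"
      by (auto simp: scalars_def GL2_def mult intro!: exI[of _ "c * d"])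
  qed
  moreover have "scalars #>\<^bsub>GL2\<^esub> A = A <#\<^bsub>GL2\<^esub> scalars" for A
    by (auto simp: r_coset_def l_coset_def scalars_def GL2_def) (metis mult)+
  ultimately show ?thesis by (intro normalI) auto
qed

lemma group_PGL2: "group PGL2"
  unfolding PGL2_def by (rule normal.factorgroup_is_group[OF normal_scalars])

type_synonym flag = "(real^2) set"

text \<open>An element of \<open>PGL2\<close> is a coset of matrices; all its members have the same effect on a
  linear subspace, so that the union below is just the image under any one of them.\<close>

definition pgl_act :: "(real^2^2) set \<Rightarrow> flag \<Rightarrow> flag" where
  "pgl_act g L = (\<Union>A\<in>g. (\<lambda>x. A *v x) ` L)"

section \<open>Positive tuples and forward domains\<close>

definition line :: "real \<Rightarrow> flag" where
  "line \<theta> = span {vector [cos \<theta>, sin \<theta>]}"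

text \<open>The map \<open>line\<close> induces a bijection between \<open>\<real>/\<pi>\<int>\<close> and the projective line. A tuple occurs
  in the counterclockwise cyclic order iff it has strictly increasing lifts spanning less than
  one period. The other cyclic order is obtained by reversing the tuple.\<close>

definition counterclockwise :: "flag list \<Rightarrow> bool" where
  "counterclockwise Fs \<longleftrightarrow>
     (\<exists>\<theta>s. Fs = map line \<theta>s \<and> sorted_wrt (<) \<theta>s \<and> last \<theta>s < hd \<theta>s + pi)"

definition positive :: "flag list \<Rightarrow> bool" where
  "positive Fs \<longleftrightarrow>
     length Fs \<ge> 3 \<and> distinct Fs \<and> (counterclockwise Fs \<or> counterclockwise (rev Fs))"

definition fU :: "flag \<Rightarrow> flag \<Rightarrow> flag \<Rightarrow> flag set" where
  "fU F H K = {G. positive [F, G, H, K]}"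

type_synonym 'a digraph = "'a set \<times> ('a \<times> 'a) set"

definition forward_domains ::
  "'a digraph \<Rightarrow> ('a \<Rightarrow> (real^2^2) set) \<Rightarrow> ('a \<Rightarrow> flag) \<Rightarrow> ('a \<Rightarrow> flag) \<Rightarrow> ('a \<Rightarrow> flag) \<Rightarrow> bool" where
  "forward_domains \<Lambda> f F H K \<longleftrightarrow>
     (\<forall>a \<in> fst \<Lambda>. positive [F a, H a, K a]) \<and>
     (\<forall>(a, b) \<in> snd \<Lambda>.
        pgl_act (f a) ` fU (F b) (H b) (K b) \<subseteq> fU (F a) (H a) (K a) \<and>
        (positive [F a, pgl_act (f a) (F b), pgl_act (f a) (H b), H a] \<or>
         positive [F a, pgl_act (f a) (H b), pgl_act (f a) (F b), H a]))"

definition admissible :: "'a digraph \<Rightarrow> ('a \<Rightarrow> (real^2^2) set) \<Rightarrow> bool" where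
  "admissible \<Lambda> f \<longleftrightarrow> (\<exists>F H K. forward_domains \<Lambda> f F H K)"

definition weakly_positive ::
  "('a \<Rightarrow> letter list) \<Rightarrow> 'a digraph \<Rightarrow> (letter list \<Rightarrow> (real^2^2) set) \<Rightarrow> bool" where
  "weakly_positive R \<Lambda> \<rho> \<longleftrightarrow> admissible \<Lambda> (\<rho> \<circ> R)"

section \<open>The graph $\Lambda_3$ and the map $R_3$\<close>

datatype idx = I1 | I2 | I3

datatype vertex = v idx | w idx | v' idx | w' idx

definition K_graph :: "'a \<Rightarrow> 'a \<Rightarrow> 'a digraph" where
  "K_graph x y = ({x, y}, {x, y} \<times> {x, y})"

definition Lambda3 :: "vertex digraph" where
  "Lambda3 =
     ((\<Union>i. fst (K_graph (v i) (w i)) \<union> fst (K_graph (v' i) (w' i))),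
      (\<Union>i. snd (K_graph (v i) (w i)) \<union> snd (K_graph (v' i) (w' i))))"

fun idx_gen :: "letter list \<Rightarrow> letter list \<Rightarrow> idx \<Rightarrow> letter list" where
  "idx_gen \<gamma>1 \<gamma>2 I1 = \<gamma>1"
| "idx_gen \<gamma>1 \<gamma>2 I2 = \<gamma>2"
| "idx_gen \<gamma>1 \<gamma>2 I3 = inv\<^bsub>F2\<^esub> \<gamma>2 \<otimes>\<^bsub>F2\<^esub> inv\<^bsub>F2\<^esub> \<gamma>1"

fun idx_next :: "idx \<Rightarrow> idx" where
  "idx_next I1 = I2"
| "idx_next I2 = I3"
| "idx_next I3 = I1"

fun R3 :: "letter list \<Rightarrow> letter list \<Rightarrow> vertex \<Rightarrow> letter list" where
  "R3 \<gamma>1 \<gamma>2 (v i) = inv\<^bsub>F2\<^esub> (idx_gen \<gamma>1 \<gamma>2 i)"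
| "R3 \<gamma>1 \<gamma>2 (w i) = idx_gen \<gamma>1 \<gamma>2 (idx_next i)"
| "R3 \<gamma>1 \<gamma>2 (v' i) = inv\<^bsub>F2\<^esub> (inv\<^bsub>F2\<^esub> (idx_gen \<gamma>1 \<gamma>2 i))"
| "R3 \<gamma>1 \<gamma>2 (w' i) = inv\<^bsub>F2\<^esub> (idx_gen \<gamma>1 \<gamma>2 (idx_next i))"

section \<open>Word metrics, axes and primitive elements\<close>

definition word_length :: "('g, 'm) monoid_scheme \<Rightarrow> 'g set \<Rightarrow> 'g \<Rightarrow> nat" where
  "word_length G S x =
     (LEAST n. \<exists>xs. length xs = n \<and> set xs \<subseteq> S \<union> m_inv G ` S \<and> foldr (mult G) xs \<one>\<^bsub>G\<^esub> = x)"

definition word_dist :: "('g, 'm) monoid_scheme \<Rightarrow> 'g set \<Rightarrow> 'g \<Rightarrow> 'g \<Rightarrow> nat" where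
  "word_dist G S x y = word_length G S (inv\<^bsub>G\<^esub> x \<otimes>\<^bsub>G\<^esub> y)"

definition is_axis :: "('g, 'm) monoid_scheme \<Rightarrow> 'g set \<Rightarrow> 'g \<Rightarrow> (int \<Rightarrow> 'g) \<Rightarrow> bool" where
  "is_axis G S \<gamma> \<eta> \<longleftrightarrow>
     \<gamma> \<in> carrier G \<and> \<gamma> \<noteq> \<one>\<^bsub>G\<^esub> \<and> range \<eta> \<subseteq> carrier G \<and>
     (\<forall>i j. int (word_dist G S (\<eta> i) (\<eta> j)) = \<bar>i - j\<bar>) \<and>
     (\<lambda>x. \<gamma> \<otimes>\<^bsub>G\<^esub> x) ` range \<eta> = range \<eta>"

definition primitive :: "('g, 'm) monoid_scheme \<Rightarrow> 'g \<Rightarrow> bool" where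
  "primitive G \<gamma> \<longleftrightarrow>
     (\<exists>T. card T = 2 \<and> T \<subseteq> carrier G \<and> generate G T = carrier G \<and> \<gamma> \<in> T)"

definition primitive_ray :: "('g, 'm) monoid_scheme \<Rightarrow> 'g set \<Rightarrow> (nat \<Rightarrow> 'g) \<Rightarrow> bool" where
  "primitive_ray G S \<eta> \<longleftrightarrow>
     (\<forall>i j. int (word_dist G S (\<eta> i) (\<eta> j)) = \<bar>int i - int j\<bar>) \<and>
     (\<exists>\<gamma> \<xi>. primitive G \<gamma> \<and> is_axis G S \<gamma> \<xi> \<and> range \<eta> \<subseteq> range \<xi>)"

section \<open>Singular values and primitive stability\<close>

definition inner_product :: "(real^2 \<Rightarrow> real^2 \<Rightarrow> real) \<Rightarrow> bool" where
  "inner_product ip \<longleftrightarrow>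
     bilinear ip \<and> (\<forall>x y. ip x y = ip y x) \<and> (\<forall>x. x \<noteq> 0 \<longrightarrow> ip x x > 0)"

text \<open>The nonnegative square roots of the eigenvalues of \<open>A\<^sup>* A\<close>, where \<open>A\<^sup>*\<close> is the adjoint with
  respect to \<open>ip\<close>: the equation \<open>A\<^sup>* A x = s\<^sup>2 x\<close> is tested against all \<open>y\<close>.\<close>

definition singular_values :: "(real^2 \<Rightarrow> real^2 \<Rightarrow> real) \<Rightarrow> real^2^2 \<Rightarrow> real set" where
  "singular_values ip A =
     {s. s \<ge> 0 \<and> (\<exists>x. x \<noteq> 0 \<and> (\<forall>y. ip (A *v x) (A *v y) = s\<^sup>2 * ip x y))}"

text \<open>The matrix chosen here is unique up to sign. In dimension two the larger and the smaller
  singular value are the maximum and the minimum of the set, also when they coincide.\<close>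

definition alpha_mu :: "(real^2 \<Rightarrow> real^2 \<Rightarrow> real) \<Rightarrow> (real^2^2) set \<Rightarrow> real" where
  "alpha_mu ip g =
     (let A = (SOME A. A \<in> g \<and> \<bar>det A\<bar> = 1)
      in ln (Max (singular_values ip A)) - ln (Min (singular_values ip A)))"

text \<open>The growth condition refers to axes of primitive elements, and for some word metrics these
  do not exist: with respect to \<open>{a\<^sup>2, a\<^sup>3, b}\<close> no geodesic is invariant under \<open>a\<close>, as the
  length of \<open>a\<^sup>n\<close> grows like \<open>n/3\<close>. The condition would say nothing about such elements, so only
  word metrics in which every primitive element has an axis are admitted (the metric of a free
  basis is one).\<close>

definition primitive_stable ::
  "(real^2 \<Rightarrow> real^2 \<Rightarrow> real) \<Rightarrow> (letter list \<Rightarrow> (real^2^2) set) \<Rightarrow> bool" where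
  "primitive_stable ip \<rho> \<longleftrightarrow>
     (\<exists>S. finite S \<and> S \<subseteq> carrier F2 \<and> generate F2 S = carrier F2 \<and>
          (\<forall>\<gamma>. primitive F2 \<gamma> \<longrightarrow> (\<exists>\<xi>. is_axis F2 S \<gamma> \<xi>)) \<and>
          (\<exists>\<kappa>>0. \<exists>\<kappa>'>0. \<forall>\<eta>. primitive_ray F2 S \<eta> \<and> \<eta> 0 = \<one>\<^bsub>F2\<^esub> \<longrightarrow>
             (\<forall>i. alpha_mu ip (\<rho> (\<eta> i)) \<ge> \<kappa> * real i - \<kappa>')))"

end

theory Submission
  imports Defs
begin

text \<open>
  The idea is to take a basis of the free group whose traces are as small as possible and to show
  that the matrices of such a basis play ping-pong.

  Elements of \<open>PGL2\<close> are represented by matrices of determinant \<open>\<plusminus>1\<close>, so that the absolute value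
  of the trace is well defined. If \<open>\<gamma>\<close> is primitive, then it translates its axis, and a conjugate
  \<open>c\<close> of \<open>\<gamma>\<close> whose word length \<open>n\<close> is the translation length satisfies
  \<open>\<alpha>(\<mu>(\<rho>(c^k))) \<ge> \<kappa> n k - \<kappa>'\<close> for all \<open>k\<close> (\<open>axis_rooted_ray\<close>). The norm of the \<open>k\<close>-th power of a
  matrix is at most a constant times \<open>k L^k\<close>, where \<open>L\<close> bounds its eigenvalues and can be chosen
  to be \<open>1\<close> unless the matrix is loxodromic and at most \<open>1 + |tr|\<close> in any case. Comparing the two
  rates gives two consequences (\<open>growth_trace\<close>): every primitive element acts loxodromically, and
  \<open>n \<le> 2 ln (1 + |tr \<rho>(\<gamma>)|) / \<kappa>\<close>. As balls in the word metric are finite, the primitive elements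
  have only finitely many values of \<open>|tr|\<close> below any given bound. Hence some basis minimises
  \<open>|tr \<rho>(\<gamma>1)| + |tr \<rho>(\<gamma>2)| + |tr \<rho>(\<gamma>1 \<gamma>2)|\<close> (\<open>minimal_basis_exists\<close>).

  This sum does not change when \<open>(\<gamma>1, \<gamma>2)\<close> is replaced by \<open>(\<gamma>2, \<gamma>3)\<close> with
  \<open>\<gamma>3 = \<gamma>2\<^sup>-\<^sup>1 \<gamma>1\<^sup>-\<^sup>1\<close>, so it is enough to look at a single pair. Let \<open>A\<close> and \<open>B\<close> represent
  \<open>\<rho>(\<gamma>1)\<^sup>-\<^sup>1\<close> and \<open>\<rho>(\<gamma>2)\<close>, with signs chosen such that both traces are positive. By the identity
  \<open>tr(AB) + det A tr(A\<^sup>-\<^sup>1 B) = tr A tr B\<close> and minimality against \<open>(\<gamma>1\<^sup>-\<^sup>1, \<gamma>2)\<close>, the trace of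
  \<open>AB\<close> is the larger one of the two summands, that is, \<open>2 tr(AB) \<ge> tr A tr B\<close>. Geometrically this
  rules out that the axes of \<open>A\<close> and \<open>B\<close> are disjoint and run in opposite directions, and
  it implies that some closed cone in the plane is mapped into its own interior by \<open>A\<close> and by \<open>B\<close>
  (\<open>common_cone_criterion\<close>). For two orientation-reversing matrices, this also uses that \<open>AB\<close> is
  hyperbolic, which minimality derives from \<open>\<rho>(\<gamma>1 \<gamma>2)\<close> being loxodromic.

  The lines in the cone form an interval, which serves as a forward domain for both vertices \<open>v\<^sub>i\<close>
  and \<open>w\<^sub>i\<close>; the inverse matrices map the complementary cone into itself, which takes care of
  \<open>v\<^sub>i'\<close> and \<open>w\<^sub>i'\<close> (\<open>contracting_pair_inverse\<close>, \<open>admissible_Lambda3I\<close>).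
\<close>

section \<open>Cyclic order on the projective line\<close>

definition wedge :: "real^2 \<Rightarrow> real^2 \<Rightarrow> real" where
  "wedge p q = p$1 * q$2 - p$2 * q$1"

definition dir :: "real \<Rightarrow> real^2" where
  "dir \<theta> = vector [cos \<theta>, sin \<theta>]"

lemma wedge_simps:
  "wedge (x + y) z = wedge x z + wedge y z" "wedge z (x + y) = wedge z x + wedge z y"
  "wedge (x - y) z = wedge x z - wedge y z" "wedge z (x - y) = wedge z x - wedge z y"
  "wedge (c *\<^sub>R x) z = c * wedge x z" "wedge z (c *\<^sub>R x) = c * wedge z x" "wedge x x = 0"
  "wedge (- x) z = - wedge x z" "wedge z (- x) = - wedge z x"
  by (simp_all add: wedge_def algebra_simps)

lemma wedge_anticommute: "wedge x y = - wedge y x"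
  by (simp add: wedge_def algebra_simps)

lemma wedge_dir: "wedge (dir \<alpha>) (dir \<beta>) = sin (\<beta> - \<alpha>)"
  by (simp add: wedge_def dir_def vector_2 sin_diff algebra_simps)

lemma span_scaleR_single: "c \<noteq> 0 \<Longrightarrow> span {c *\<^sub>R x} = span {x :: real^2}"
  by (rule span_image_scale[of "{x}" "\<lambda>_. c", simplified])

lemma line_eq_span_dir: "line \<theta> = span {dir \<theta>}"
  by (simp add: line_def dir_def)

lemma wedge_expand:
  assumes "wedge p q \<noteq> 0"
  shows "x = (wedge x q / wedge p q) *\<^sub>R p + (wedge p x / wedge p q) *\<^sub>R q"
proof -
  have "wedge p q *\<^sub>R x = wedge x q *\<^sub>R p + wedge p x *\<^sub>R q"
    by (simp add: vec_eq_iff forall_2 wedge_def algebra_simps)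
  then have "(1 / wedge p q) *\<^sub>R wedge p q *\<^sub>R x =
      (1 / wedge p q) *\<^sub>R (wedge x q *\<^sub>R p + wedge p x *\<^sub>R q)" by simp
  then show ?thesis using assms by (simp add: scaleR_add_right)
qed

lemma wedge_eq_0D:
  assumes "wedge p q = 0" "p \<noteq> 0"
  obtains c where "q = c *\<^sub>R p"
proof -
  have "p$1 \<noteq> 0 \<or> p$2 \<noteq> 0" using assms(2) by (auto simp: vec_eq_iff forall_2)
  then have "\<exists>c. q = c *\<^sub>R p"
  proof
    assume "p$1 \<noteq> 0"
    then have "q = (q$1 / p$1) *\<^sub>R p"
      using assms(1) by (simp add: vec_eq_iff forall_2 wedge_def field_simps)
    then show ?thesis by blast
  next
    assume "p$2 \<noteq> 0"
    then have "q = (q$2 / p$2) *\<^sub>R p"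
      using assms(1) by (simp add: vec_eq_iff forall_2 wedge_def field_simps)
    then show ?thesis by blast
  qed
  with that show ?thesis by blast
qed

lemma span_eq_lineD:
  assumes "span {p} = line \<theta>"
  obtains c where "c \<noteq> 0" "p = c *\<^sub>R dir \<theta>"
proof -
  have "p \<in> span {dir \<theta>}" using assms span_base[of p "{p}"] by (simp add: line_eq_span_dir)
  then obtain c where c: "p = c *\<^sub>R dir \<theta>" by (auto simp: span_singleton)
  have "dir \<theta> \<noteq> 0"
  proof
    assume "dir \<theta> = 0"
    then have "cos \<theta> = 0 \<and> sin \<theta> = 0" by (simp add: dir_def vec_eq_iff forall_2 vector_2)
    then show False using sin_cos_squared_add[of \<theta>] by simp
  qed
  moreover have "dir \<theta> \<in> span {p}"
    using assms span_base[of "dir \<theta>" "{dir \<theta>}"] by (simp add: line_eq_span_dir)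
  ultimately have "c \<noteq> 0" using c by auto
  with c that show ?thesis by blast
qed

lemma dir_window:
  assumes "p \<noteq> 0"
  obtains \<theta> c where "t \<le> \<theta>" "\<theta> < t + pi" "c \<noteq> 0" "p = c *\<^sub>R dir \<theta>"
proof -
  define r where "r = sqrt ((p$1)\<^sup>2 + (p$2)\<^sup>2)"
  have "p$1 \<noteq> 0 \<or> p$2 \<noteq> 0" using assms by (auto simp: vec_eq_iff forall_2)
  then have "(p$1)\<^sup>2 + (p$2)\<^sup>2 > 0" by (simp add: sum_power2_gt_zero_iff)
  then have r: "r > 0" "r\<^sup>2 = (p$1)\<^sup>2 + (p$2)\<^sup>2" by (simp_all add: r_def)
  have "(p$1 / r)\<^sup>2 + (p$2 / r)\<^sup>2 = ((p$1)\<^sup>2 + (p$2)\<^sup>2) / r\<^sup>2"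
    by (simp add: power_divide add_divide_distrib)
  then have "(p$1 / r)\<^sup>2 + (p$2 / r)\<^sup>2 = 1" using r(1) by (simp flip: r(2))
  then obtain \<phi> where \<phi>: "p$1 / r = cos \<phi>" "p$2 / r = sin \<phi>"
    by (metis sincos_total_2pi)
  define k where "k = \<lfloor>(\<phi> - t) / pi\<rfloor>"
  define \<theta> where "\<theta> = \<phi> - of_int k * pi"
  have "of_int k \<le> (\<phi> - t) / pi" "(\<phi> - t) / pi < of_int k + 1"
    unfolding k_def by linarith+
  then have win: "t \<le> \<theta>" "\<theta> < t + pi"
    by (simp_all add: \<theta>_def field_simps)
  have s: "sin (of_int k * pi) = 0" by (simp add: sin_zero_iff_int2)
  define \<epsilon> where "\<epsilon> = cos (of_int k * pi :: real)"
  have \<epsilon>: "\<epsilon> * \<epsilon> = 1"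
    using sin_cos_squared_add[of "of_int k * pi :: real"] s by (simp add: \<epsilon>_def power2_eq_square)
  have "cos \<theta> = \<epsilon> * cos \<phi>" "sin \<theta> = \<epsilon> * sin \<phi>"
    by (simp_all add: \<theta>_def cos_diff sin_diff s \<epsilon>_def)
  then have "p = (r * \<epsilon>) *\<^sub>R dir \<theta>"
    using \<phi> r \<epsilon> by (simp add: vec_eq_iff forall_2 dir_def vector_2 field_simps)
  moreover have "r * \<epsilon> \<noteq> 0" using r \<epsilon> by auto
  ultimately show ?thesis using win that by blast
qed

lemma positive_4E:
  assumes "positive [P, Q, R, S]"
  obtains a b c d where "a < b" "b < c" "c < d" "d < a + pi"
    and "P = line a \<and> Q = line b \<and> R = line c \<and> S = line d \<or>
         P = line d \<and> Q = line c \<and> R = line b \<and> S = line a"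
proof -
  have *: "\<exists>a b c d. Fs = [line a, line b, line c, line d] \<and> a < b \<and> b < c \<and> c < d \<and> d < a + pi"
    if ccw: "counterclockwise Fs" and len: "length Fs = 4" for Fs
  proof -
    obtain \<theta>s where \<theta>s: "Fs = map line \<theta>s" "sorted_wrt (<) \<theta>s" "last \<theta>s < hd \<theta>s + pi"
      using ccw unfolding counterclockwise_def by blast
    then have "length \<theta>s = 4" using len by simp
    then obtain a b c d where "\<theta>s = [a, b, c, d]"
      by (auto simp: length_Suc_conv numeral_eq_Suc)
    with \<theta>s show ?thesis by (intro exI[of _ a] exI[of _ b] exI[of _ c] exI[of _ d]) simp
  qed
  have "counterclockwise [P, Q, R, S] \<or> counterclockwise [S, R, Q, P]"
    using assms by (simp add: positive_def)
  then show ?thesis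
  proof
    assume "counterclockwise [P, Q, R, S]"
    from *[OF this] that show ?thesis by auto
  next
    assume "counterclockwise [S, R, Q, P]"
    from *[OF this] that show ?thesis by auto
  qed
qed

lemma line_neq: "\<theta> < \<phi> \<Longrightarrow> \<phi> < \<theta> + pi \<Longrightarrow> line \<theta> \<noteq> line \<phi>"
proof
  assume *: "\<theta> < \<phi>" "\<phi> < \<theta> + pi" "line \<theta> = line \<phi>"
  then obtain c where "dir \<theta> = c *\<^sub>R dir \<phi>"
    using span_eq_lineD[of "dir \<theta>" \<phi>] by (auto simp: line_eq_span_dir)
  then have "wedge (dir \<theta>) (dir \<phi>) = 0" by (simp add: wedge_simps)
  then show False using * sin_gt_zero[of "\<phi> - \<theta>"] by (simp add: wedge_dir)
qed

lemma positive_4I: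
  assumes "a < b" "b < c" "c < d" "d < a + pi"
  shows "positive [line a, line b, line c, line d]" "positive [line d, line c, line b, line a]"
proof -
  have *: "counterclockwise [line a, line b, line c, line d]"
    unfolding counterclockwise_def using assms by (intro exI[of _ "[a, b, c, d]"]) auto
  have "distinct [line a, line b, line c, line d]" using assms line_neq by auto
  with * show "positive [line a, line b, line c, line d]" "positive [line d, line c, line b, line a]"
    by (auto simp: positive_def)
qed

lemma positive_tripleI:
  assumes "positive [P, Q, R, S]"
  shows "positive [P, R, S]"
  using assms
proof (rule positive_4E)
  fix a b c d
  assume *: "a < b" "b < c" "c < d" "d < a + pi"
    "P = line a \<and> Q = line b \<and> R = line c \<and> S = line d \<or>
     P = line d \<and> Q = line c \<and> R = line b \<and> S = line a"
  have "counterclockwise [line a, line c, line d]" "counterclockwise [line a, line b, line d]"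
    unfolding counterclockwise_def using *
    by (auto intro: exI[of _ "[a, c, d]"] exI[of _ "[a, b, d]"])
  moreover have "distinct [P, R, S]" using assms by (simp add: positive_def)
  ultimately show ?thesis using *(5) by (auto simp: positive_def)
qed

text \<open>Each of the four vectors occurs twice in the product, so its sign depends on the lines alone. With
  unit vectors the factors are sines of differences of angles, and the three ways to separate four
  points of a circle into pairs are told apart by the signs. Since a matrix multiplies every factor
  by its determinant, the criterion makes the invariance of positivity under matrices visible.\<close>

lemma positive_span_iff:
  "positive [span {p}, span {q}, span {r}, span {s}] \<longleftrightarrow>
     wedge p q * wedge q r * wedge r s * wedge p s > 0" (is "?L \<longleftrightarrow> ?W > 0")
proof
  assume ?L
  then show "?W > 0"
  proof (rule positive_4E)
    fix a b c d
    assume *: "a < b" "b < c" "c < d" "d < a + pi"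
      "span {p} = line a \<and> span {q} = line b \<and> span {r} = line c \<and> span {s} = line d \<or>
       span {p} = line d \<and> span {q} = line c \<and> span {r} = line b \<and> span {s} = line a"
    have sines: "sin (b - a) > 0" "sin (c - b) > 0" "sin (d - c) > 0" "sin (d - a) > 0"
      using *(1-4) by (auto intro!: sin_gt_zero)
    from *(5) show "?W > 0"
    proof
      assume "span {p} = line a \<and> span {q} = line b \<and> span {r} = line c \<and> span {s} = line d"
      then have sp: "span {p} = line a" "span {q} = line b" "span {r} = line c" "span {s} = line d" by auto
      obtain A where p: "A \<noteq> 0" "p = A *\<^sub>R dir a" by (rule span_eq_lineD[OF sp(1)])
      obtain B where q: "B \<noteq> 0" "q = B *\<^sub>R dir b" by (rule span_eq_lineD[OF sp(2)])
      obtain C where r: "C \<noteq> 0" "r = C *\<^sub>R dir c" by (rule span_eq_lineD[OF sp(3)])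
      obtain D where s: "D \<noteq> 0" "s = D *\<^sub>R dir d" by (rule span_eq_lineD[OF sp(4)])
      note nz = p(1) q(1) r(1) s(1) and eq = p(2) q(2) r(2) s(2)
      have "?W = (A * B * C * D)\<^sup>2 * (sin (b - a) * sin (c - b) * sin (d - c) * sin (d - a))"
        unfolding eq by (simp add: wedge_simps wedge_dir power2_eq_square mult_ac)
      then show ?thesis using nz sines by simp
    next
      assume "span {p} = line d \<and> span {q} = line c \<and> span {r} = line b \<and> span {s} = line a"
      then have sp: "span {p} = line d" "span {q} = line c" "span {r} = line b" "span {s} = line a" by auto
      obtain D where p: "D \<noteq> 0" "p = D *\<^sub>R dir d" by (rule span_eq_lineD[OF sp(1)])
      obtain C where q: "C \<noteq> 0" "q = C *\<^sub>R dir c" by (rule span_eq_lineD[OF sp(2)])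
      obtain B where r: "B \<noteq> 0" "r = B *\<^sub>R dir b" by (rule span_eq_lineD[OF sp(3)])
      obtain A where s: "A \<noteq> 0" "s = A *\<^sub>R dir a" by (rule span_eq_lineD[OF sp(4)])
      note nz = p(1) q(1) r(1) s(1) and eq = p(2) q(2) r(2) s(2)
      have "sin (c - d) = - sin (d - c)" "sin (b - c) = - sin (c - b)" "sin (a - b) = - sin (b - a)"
        "sin (a - d) = - sin (d - a)"
        using sin_minus[of "d - c"] sin_minus[of "c - b"] sin_minus[of "b - a"] sin_minus[of "d - a"]
        by simp_all
      then have "?W = (A * B * C * D)\<^sup>2 * (sin (b - a) * sin (c - b) * sin (d - c) * sin (d - a))"
        unfolding eq by (simp add: wedge_simps wedge_dir power2_eq_square mult_ac)
      then show ?thesis using nz sines by simp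
    qed
  qed
next
  assume W: "?W > 0"
  then have nz: "p \<noteq> 0" "q \<noteq> 0" "r \<noteq> 0" "s \<noteq> 0" by (auto simp: wedge_def)
  obtain a A where a: "0 \<le> a" "a < 0 + pi" "A \<noteq> 0" "p = A *\<^sub>R dir a"
    by (rule dir_window[OF nz(1)])
  obtain b B where b: "a \<le> b" "b < a + pi" "B \<noteq> 0" "q = B *\<^sub>R dir b" by (rule dir_window[OF nz(2)])
  obtain c C where c: "a \<le> c" "c < a + pi" "C \<noteq> 0" "r = C *\<^sub>R dir c" by (rule dir_window[OF nz(3)])
  obtain d D where d: "a \<le> d" "d < a + pi" "D \<noteq> 0" "s = D *\<^sub>R dir d" by (rule dir_window[OF nz(4)])
  have spans: "span {p} = line a" "span {q} = line b" "span {r} = line c" "span {s} = line d"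
    unfolding a(4) b(4) c(4) d(4) line_eq_span_dir
    using a(3) b(3) c(3) d(3) by (simp_all add: span_scaleR_single)
  have "?W = (A * B * C * D)\<^sup>2 * (sin (b - a) * sin (c - b) * sin (d - c) * sin (d - a))"
    unfolding a(4) b(4) c(4) d(4) by (simp add: wedge_simps wedge_dir power2_eq_square mult_ac)
  moreover have "(A * B * C * D)\<^sup>2 > 0" using a(3) b(3) c(3) d(3) by simp
  ultimately have S: "sin (b - a) * sin (c - b) * sin (d - c) * sin (d - a) > 0"
    using W by (metis zero_less_mult_pos)
  have ba: "b \<noteq> a" and da: "d \<noteq> a" using S by auto
  have s1: "sin (b - a) > 0" "sin (d - a) > 0" using ba da b(1,2) d(1,2) by (auto intro!: sin_gt_zero)
  have S2: "sin (c - b) * sin (d - c) > 0"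
  proof -
    have "(sin (b - a) * sin (d - a)) * (sin (c - b) * sin (d - c)) > 0" using S by (simp add: mult_ac)
    then show ?thesis using mult_pos_pos[OF s1] zero_less_mult_pos by blast
  qed
  have sin_pos: "sin (y - x) > 0" if "x < y" "a \<le> x" "y < a + pi" for x y
    using that by (intro sin_gt_zero) linarith+
  have sgn: "x < y" if "sin (y - x) > 0" "a \<le> y" "x < a + pi" for x y
  proof (rule ccontr)
    assume "\<not> x < y"
    moreover have "x \<noteq> y" using that by auto
    ultimately have "sin (x - y) > 0" using that by (intro sin_pos) auto
    then show False using that sin_minus[of "y - x"] by simp
  qed
  consider "sin (c - b) > 0" "sin (d - c) > 0" | "sin (b - c) > 0" "sin (c - d) > 0"
    using S2 sin_minus[of "c - b"] sin_minus[of "d - c"] by (auto simp: zero_less_mult_iff)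
  then show ?L
  proof cases
    case 1
    then have "b < c" "c < d" using sgn b(1,2) c(1,2) d(1,2) by blast+
    then show ?thesis unfolding spans using positive_4I(1)[of a b c d] ba b(1,2) d(1,2) by linarith
  next
    case 2
    then have "c < b" "d < c" using sgn b(1,2) c(1,2) d(1,2) by blast+
    moreover have "line (a + pi) = line a"
    proof -
      have "dir (a + pi) = (-1) *\<^sub>R dir a" by (simp add: dir_def vec_eq_iff forall_2 vector_2)
      then show ?thesis using span_scaleR_single[of "-1" "dir a"] by (simp add: line_eq_span_dir)
    qed
    ultimately show ?thesis unfolding spans
      using positive_4I(2)[of d c b "a + pi"] da b(1,2) d(1,2) by simp
  qed
qed

section \<open>Cones and forward domains\<close>

definition proj :: "real^2^2 \<Rightarrow> (real^2^2) set" where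
  "proj A = {c *\<^sub>R A | c. c \<noteq> 0}"

definition preserves_cone :: "real^2 \<Rightarrow> real^2 \<Rightarrow> real^2^2 \<Rightarrow> bool" where
  "preserves_cone x y A \<longleftrightarrow> (\<exists>p q r s. 0 < p \<and> 0 < q \<and> 0 < r \<and> 0 < s \<and>
     A *v x = p *\<^sub>R x + r *\<^sub>R y \<and> A *v y = q *\<^sub>R x + s *\<^sub>R y)"

text \<open>The two elements have a common ping-pong domain: representatives of both map the closed cone
  spanned by \<open>x\<close> and \<open>y\<close> into its interior, up to the origin.\<close>

definition contracting_pair :: "(real^2^2) set \<Rightarrow> (real^2^2) set \<Rightarrow> bool" where
  "contracting_pair g h \<longleftrightarrow> (\<exists>x y A B. wedge x y \<noteq> 0 \<and> invertible A \<and> invertible B \<and>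
     g = proj A \<and> h = proj B \<and> preserves_cone x y A \<and> preserves_cone x y B)"

lemma scaleR_matrix_vector: "(c *\<^sub>R A) *v x = c *\<^sub>R (A *v x)" for A :: "real^'n^'m"
  by (rule scaleR_matrix_vector_assoc[symmetric])

lemma proj_scaleR: "c \<noteq> 0 \<Longrightarrow> proj (c *\<^sub>R A) = proj A"
proof -
  assume "c \<noteq> 0"
  have "\<exists>d'. d *\<^sub>R A = d' *\<^sub>R c *\<^sub>R A \<and> d' \<noteq> 0" if "d \<noteq> 0" for d
    using that \<open>c \<noteq> 0\<close> by (intro exI[of _ "d / c"]) simp
  then show ?thesis using \<open>c \<noteq> 0\<close> by (auto simp: proj_def)
qed

lemma pgl_act_proj_span: "pgl_act (proj A) (span {x}) = span {A *v x}"
proof -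
  have "(\<lambda>z. (c *\<^sub>R A) *v z) ` span {x} = span {A *v x}" if "c \<noteq> 0" for c
  proof -
    have "(\<lambda>z. (c *\<^sub>R A) *v z) ` span {x} = span ((\<lambda>z. (c *\<^sub>R A) *v z) ` {x})"
      by (rule linear_span_image[symmetric]) simp
    also have "\<dots> = span {A *v x}"
      using span_scaleR_single[OF that, of "A *v x"] by (simp add: scaleR_matrix_vector)
    finally show ?thesis .
  qed
  then have eq: "(\<Union>c\<in>{c. c \<noteq> 0}. (\<lambda>z. (c *\<^sub>R A) *v z) ` span {x}) = (\<Union>c\<in>{c::real. c \<noteq> 0}. span {A *v x})"
    by (intro SUP_cong) auto
  have "pgl_act (proj A) (span {x}) = (\<Union>c\<in>{c. c \<noteq> 0}. (\<lambda>z. (c *\<^sub>R A) *v z) ` span {x})"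
    unfolding pgl_act_def proj_def by blast
  also have "\<dots> = (\<Union>c\<in>{c::real. c \<noteq> 0}. span {A *v x})" by (rule eq)
  also have "\<dots> = span {A *v x}" by (simp only: UN_constant) (auto intro: exI[of _ "1::real"])
  finally show ?thesis .
qed

lemma positive_span_ends:
  assumes "wedge x y \<noteq> 0"
  shows "positive [span {x}, span {a *\<^sub>R x + b *\<^sub>R y}, span {y}, span {x - y}] \<longleftrightarrow> a * b > 0"
proof -
  have "wedge x (a *\<^sub>R x + b *\<^sub>R y) * wedge (a *\<^sub>R x + b *\<^sub>R y) y * wedge y (x - y) * wedge x (x - y)
      = (a * b) * ((wedge x y)\<^sup>2)\<^sup>2"
    using wedge_anticommute[of y x]
    by (simp add: wedge_simps power2_eq_square algebra_simps)
  then show ?thesis unfolding positive_span_iff using assms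
    by (simp add: zero_less_mult_iff)
qed

text \<open>The third flag only has to lie outside the cone spanned by \<open>x\<close> and \<open>y\<close>; the line through
  \<open>x - y\<close> is such a line.\<close>

lemma fU_span:
  assumes "wedge x y \<noteq> 0"
  shows "fU (span {x}) (span {y}) (span {x - y}) = {span {a *\<^sub>R x + b *\<^sub>R y} | a b. a * b > 0}"
proof (intro equalityI subsetI)
  fix G assume "G \<in> fU (span {x}) (span {y}) (span {x - y})"
  then have pos: "positive [span {x}, G, span {y}, span {x - y}]" by (simp add: fU_def)
  then obtain \<theta> where "G = line \<theta>" by (rule positive_4E) auto
  then have G: "G = span {dir \<theta>}" by (simp add: line_eq_span_dir)
  obtain a b where ab: "dir \<theta> = a *\<^sub>R x + b *\<^sub>R y" using wedge_expand[OF assms] by blast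
  then have "a * b > 0" using pos positive_span_ends[OF assms] G by simp
  then show "G \<in> {span {a *\<^sub>R x + b *\<^sub>R y} | a b. a * b > 0}" using G ab by auto
qed (auto simp: fU_def positive_span_ends[OF assms])

lemma preserves_cone_fU:
  assumes w: "wedge x y \<noteq> 0" and A: "preserves_cone x y A"
  shows "pgl_act (proj A) ` fU (span {x}) (span {y}) (span {x - y})
    \<subseteq> fU (span {x}) (span {y}) (span {x - y})"
proof -
  obtain p q r s where pos: "0 < p" "0 < q" "0 < r" "0 < s" and
    eq: "A *v x = p *\<^sub>R x + r *\<^sub>R y" "A *v y = q *\<^sub>R x + s *\<^sub>R y"
    using A by (auto simp: preserves_cone_def)
  have "A *v (a *\<^sub>R x + b *\<^sub>R y) = (p * a + q * b) *\<^sub>R x + (r * a + s * b) *\<^sub>R y" for a b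
    by (simp add: matrix_vector_right_distrib matrix_vector_mult_scaleR eq algebra_simps)
  moreover have "(p * a + q * b) * (r * a + s * b) > 0" if "a * b > 0" for a b
    using that pos by (auto simp: zero_less_mult_iff intro: add_pos_pos add_neg_neg mult_pos_neg)
  ultimately show ?thesis unfolding fU_span[OF w] by (auto simp: pgl_act_proj_span) blast
qed

lemma preserves_cone_positive:
  assumes w: "wedge x y \<noteq> 0" and A: "preserves_cone x y A" and inv: "invertible A"
  shows "positive [span {x}, pgl_act (proj A) (span {x}), pgl_act (proj A) (span {y}), span {y}] \<or>
         positive [span {x}, pgl_act (proj A) (span {y}), pgl_act (proj A) (span {x}), span {y}]"
proof -
  obtain p q r s where pos: "0 < p" "0 < q" "0 < r" "0 < s" and
    eq: "A *v x = p *\<^sub>R x + r *\<^sub>R y" "A *v y = q *\<^sub>R x + s *\<^sub>R y"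
    using A by (auto simp: preserves_cone_def)
  have "p * s - q * r \<noteq> 0"
  proof
    assume 0: "p * s - q * r = 0"
    have "A *v (s *\<^sub>R x - r *\<^sub>R y) = (p * s - q * r) *\<^sub>R x"
      by (simp add: matrix_vector_mult_diff_distrib matrix_vector_mult_scaleR eq algebra_simps)
    then have "A *v (s *\<^sub>R x - r *\<^sub>R y) = A *v 0" using 0 by simp
    then have "s *\<^sub>R x - r *\<^sub>R y = 0" by (rule inj_matrix_vector_mult[OF inv, THEN injD])
    then have "wedge (s *\<^sub>R x - r *\<^sub>R y) y = 0" by (simp add: wedge_def)
    then show False using w pos by (simp add: wedge_simps)
  qed
  moreover have "wedge x (A *v x) * wedge (A *v x) (A *v y) * wedge (A *v y) y * wedge x y =
      (q * r) * (p * s - q * r) * ((wedge x y)\<^sup>2)\<^sup>2"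
    "wedge x (A *v y) * wedge (A *v y) (A *v x) * wedge (A *v x) y * wedge x y =
      (p * s) * (q * r - p * s) * ((wedge x y)\<^sup>2)\<^sup>2"
    unfolding eq using wedge_anticommute[of y x]
    by (simp_all add: wedge_simps power2_eq_square algebra_simps)
  ultimately show ?thesis unfolding pgl_act_proj_span positive_span_iff using pos w
    by (auto simp: zero_less_mult_iff neq_iff)
qed

text \<open>The lines outside a cone spanned by \<open>x\<close> and \<open>y\<close> are those in the cone spanned by \<open>x\<close> and \<open>-y\<close>.
  In coordinates, the adjugate of a matrix with positive entries has positive diagonal and negative
  off-diagonal entries. The sign in the conclusion is that of the determinant.\<close>

lemma preserves_cone_inverse:
  assumes w: "wedge x y \<noteq> 0" and A: "preserves_cone x y A" and BA: "B ** A = mat 1"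
  shows "preserves_cone x (- y) B \<or> preserves_cone x (- y) (- B)"
proof -
  obtain p q r s where pos: "0 < p" "0 < q" "0 < r" "0 < s" and
    eq: "A *v x = p *\<^sub>R x + r *\<^sub>R y" "A *v y = q *\<^sub>R x + s *\<^sub>R y"
    using A by (auto simp: preserves_cone_def)
  define D where "D = p * s - q * r"
  have BAz: "B *v (A *v z) = z" for z by (simp add: matrix_vector_mul_assoc BA)
  have "D *\<^sub>R x = s *\<^sub>R (A *v x) - r *\<^sub>R (A *v y)" "D *\<^sub>R y = p *\<^sub>R (A *v y) - q *\<^sub>R (A *v x)"
    unfolding D_def eq by (simp_all add: algebra_simps)
  then have "B *v (D *\<^sub>R x) = B *v (s *\<^sub>R (A *v x) - r *\<^sub>R (A *v y))"
    "B *v (D *\<^sub>R y) = B *v (p *\<^sub>R (A *v y) - q *\<^sub>R (A *v x))" by simp_all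
  then have DB: "D *\<^sub>R (B *v x) = s *\<^sub>R x - r *\<^sub>R y" "D *\<^sub>R (B *v y) = p *\<^sub>R y - q *\<^sub>R x"
    by (simp_all add: matrix_vector_mult_diff_distrib matrix_vector_mult_scaleR BAz)
  have D: "D \<noteq> 0"
  proof
    assume "D = 0"
    then have "wedge (s *\<^sub>R x - r *\<^sub>R y) y = 0" using DB(1) by (simp add: wedge_def)
    then show False using w pos by (simp add: wedge_simps)
  qed
  have "B *v x = (1 / D) *\<^sub>R (D *\<^sub>R (B *v x))" "B *v y = (1 / D) *\<^sub>R (D *\<^sub>R (B *v y))"
    using D by simp_all
  then have B: "B *v x = (s / D) *\<^sub>R x + (r / D) *\<^sub>R (- y)" "B *v (- y) = (q / D) *\<^sub>R x + (p / D) *\<^sub>R (- y)"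
    unfolding DB using matrix_vector_mult_scaleR[of B "-1" y] by (simp_all add: algebra_simps)
  have mB: "(- B) *v z = - (B *v z)" for z
    using scaleR_matrix_vector[of "-1" B z] by simp
  show ?thesis
  proof (cases "D > 0")
    case True
    then show ?thesis unfolding preserves_cone_def using B pos by (metis divide_pos_pos)
  next
    case False
    then have "- D > 0" using D by simp
    moreover have "(- B) *v x = (s / - D) *\<^sub>R x + (r / - D) *\<^sub>R (- y)"
      "(- B) *v (- y) = (q / - D) *\<^sub>R x + (p / - D) *\<^sub>R (- y)"
      unfolding mB B by (simp_all add: algebra_simps)
    ultimately show ?thesis unfolding preserves_cone_def using pos by (metis divide_pos_pos)
  qed
qed

lemma contracting_pair_inverse:
  assumes "contracting_pair (proj A) (proj B)" "invertible A" "invertible B" "A' ** A = mat 1" "B' ** B = mat 1"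
  shows "contracting_pair (proj A') (proj B')"
proof -
  obtain x y C D where w: "wedge x y \<noteq> 0" and eq: "proj A = proj C" "proj B = proj D" and
    cone: "preserves_cone x y C" "preserves_cone x y D"
    using assms(1) by (auto simp: contracting_pair_def)
  have key: "\<exists>E. proj E = proj M' \<and> invertible E \<and> preserves_cone x (- y) E"
    if "proj M = proj N" "preserves_cone x y N" "M' ** M = mat 1" for M M' N :: "real^2^2"
  proof -
    have "N \<in> proj N" by (auto simp: proj_def intro: exI[of _ "1::real"])
    then have "N \<in> proj M" by (simp only: that(1))
    then obtain c where c: "c \<noteq> 0" "N = c *\<^sub>R M" by (auto simp: proj_def)
    have "((1 / c) *\<^sub>R M') ** N = mat 1"
      using c that(3) by (simp add: matrix_scalar_ac scalar_matrix_assoc[symmetric])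
    from preserves_cone_inverse[OF w that(2) this]
    have "\<exists>d. d \<noteq> 0 \<and> preserves_cone x (- y) (d *\<^sub>R M')"
    proof (elim disjE)
      assume "preserves_cone x (- y) ((1 / c) *\<^sub>R M')" 
      then show ?thesis using c by (intro exI[of _ "1 / c"]) auto
    next
      assume "preserves_cone x (- y) (- ((1 / c) *\<^sub>R M'))"
      then have "preserves_cone x (- y) ((- (1 / c)) *\<^sub>R M')" by simp
      then show ?thesis using c by (intro exI[of _ "- (1 / c)"]) auto
    qed
    then obtain d where d: "d \<noteq> 0" "preserves_cone x (- y) (d *\<^sub>R M')" by blast
    have "(d *\<^sub>R M') ** ((1/d) *\<^sub>R M) = mat 1"
      using d that(3) by (simp add: matrix_scalar_ac scalar_matrix_assoc[symmetric])
    then have "invertible (d *\<^sub>R M')" using invertible_right_inverse by blast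
    then show ?thesis using d proj_scaleR by blast
  qed
  obtain E where E: "proj E = proj A'" "invertible E" "preserves_cone x (- y) E"
    using key[OF eq(1) cone(1) assms(4)] by blast
  obtain F where F: "proj F = proj B'" "invertible F" "preserves_cone x (- y) F"
    using key[OF eq(2) cone(2) assms(5)] by blast
  have "wedge x (- y) \<noteq> 0" using w by (simp add: wedge_simps)
  then show ?thesis unfolding contracting_pair_def using E F by metis
qed

text \<open>In each of the six components, one interval is used for both vertices. Then all four edges
  of a component impose conditions on one and the same interval.\<close>

lemma admissible_Lambda3I:
  assumes "\<And>i. contracting_pair (f (v i)) (f (w i))" "\<And>i. contracting_pair (f (v' i)) (f (w' i))"
  shows "admissible Lambda3 f"
proof -
  define good where "good p q g \<longleftrightarrow> (\<exists>A. invertible A \<and> g = proj A \<and> preserves_cone p q A)" for p q g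
  have "\<forall>i. \<exists>x y. wedge x y \<noteq> 0 \<and> good x y (f (v i)) \<and> good x y (f (w i))"
    "\<forall>i. \<exists>x y. wedge x y \<noteq> 0 \<and> good x y (f (v' i)) \<and> good x y (f (w' i))"
    using assms unfolding contracting_pair_def good_def by metis+
  then obtain x y x' y' where
    xy: "\<And>i. wedge (x i) (y i) \<noteq> 0 \<and> good (x i) (y i) (f (v i)) \<and> good (x i) (y i) (f (w i))" and
    xy': "\<And>i. wedge (x' i) (y' i) \<noteq> 0 \<and> good (x' i) (y' i) (f (v' i)) \<and> good (x' i) (y' i) (f (w' i))"
    by metis
  define P where "P a = (case a of v i \<Rightarrow> x i | w i \<Rightarrow> x i | v' i \<Rightarrow> x' i | w' i \<Rightarrow> x' i)" for a
  define Q where "Q a = (case a of v i \<Rightarrow> y i | w i \<Rightarrow> y i | v' i \<Rightarrow> y' i | w' i \<Rightarrow> y' i)" for a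
  have good: "wedge (P a) (Q a) \<noteq> 0 \<and> good (P a) (Q a) (f a)" for a
    using xy xy' by (cases a) (simp_all add: P_def Q_def)
  have edge: "P a = P b \<and> Q a = Q b" if "(a, b) \<in> snd Lambda3" for a b
    using that by (auto simp: Lambda3_def K_graph_def P_def Q_def)
  have "forward_domains Lambda3 f (\<lambda>a. span {P a}) (\<lambda>a. span {Q a}) (\<lambda>a. span {P a - Q a})"
    unfolding forward_domains_def
  proof (intro conjI ballI, goal_cases)
    case (1 a)
    have "positive [span {P a}, span {1 *\<^sub>R P a + 1 *\<^sub>R Q a}, span {Q a}, span {P a - Q a}]"
      using good by (subst positive_span_ends) auto
    then show ?case by (rule positive_tripleI)
  next
    case (2 e)
    obtain a b where e: "e = (a, b)" by fastforce
    then have eq: "P b = P a" "Q b = Q a" using edge 2 by auto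
    from good[of a] obtain A where "invertible A" "f a = proj A" "preserves_cone (P a) (Q a) A"
      "wedge (P a) (Q a) \<noteq> 0" by (auto simp: good_def)
    then show ?case unfolding e using preserves_cone_fU preserves_cone_positive by (simp add: eq)
  qed
  then show ?thesis unfolding admissible_def by blast
qed

section \<open>Pairs of matrices with a common invariant cone\<close>

definition common_cone :: "real^2^2 \<Rightarrow> real^2^2 \<Rightarrow> bool" where
  "common_cone A B \<longleftrightarrow> (\<exists>x y. wedge x y \<noteq> 0 \<and> preserves_cone x y A \<and> preserves_cone x y B)"

lemma common_cone_commute: "common_cone A B \<Longrightarrow> common_cone B A"
  by (auto simp: common_cone_def)

lemma trace_2: "trace (A :: real^2^2) = A$1$1 + A$2$2"
  by (simp add: trace_def sum_2)

lemma matrix_vector_2: "((A :: real^2^2) *v x) $ i = A$i$1 * x$1 + A$i$2 * x$2"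
  by (simp add: matrix_vector_mult_def sum_2)

lemma matrix_matrix_2: "((A :: real^2^2) ** B) $ i $ j = A$i$1 * B$1$j + A$i$2 * B$2$j"
  by (simp add: matrix_matrix_mult_def sum_2)

lemma trace_wedge: "wedge (A *v x) y + wedge x (A *v y) = trace A * wedge x y"
  by (simp add: wedge_def matrix_vector_2 trace_2 algebra_simps)

lemma det_wedge: "wedge (A *v x) (A *v y) = det A * wedge x y"
  by (simp add: wedge_def matrix_vector_2 det_2 algebra_simps)

lemma basis_trace_det:
  assumes "wedge x y \<noteq> 0" "A *v x = p *\<^sub>R x + r *\<^sub>R y" "A *v y = q *\<^sub>R x + s *\<^sub>R y"
  shows "trace A = p + s" "det A = p * s - q * r"
proof -
  have "trace A * wedge x y = (p + s) * wedge x y"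
    unfolding trace_wedge[symmetric] assms(2,3) by (simp add: wedge_simps algebra_simps)
  then show "trace A = p + s" using assms(1) by simp
  have "det A * wedge x y = (p * s - q * r) * wedge x y"
    unfolding det_wedge[symmetric] assms(2,3) using wedge_anticommute[of y x]
    by (simp add: wedge_simps algebra_simps)
  then show "det A = p * s - q * r" using assms(1) by simp
qed

lemma basis_coordinates:
  assumes "wedge x y \<noteq> 0"
  obtains p q where "z = p *\<^sub>R x + q *\<^sub>R y"
  using wedge_expand[OF assms] by blast

text \<open>By the characteristic equation, the two vectors \<open>(A12, l - A11)\<close> and \<open>(l - A22, A21)\<close> are
  eigenvectors, provided that they are not zero. If both vanish, then the first unit vector is one.\<close>

lemma eigenvector_exists:
  fixes A :: "real^2^2"
  assumes "l\<^sup>2 - trace A * l + det A = 0"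
  obtains e where "e \<noteq> 0" "A *v e = l *\<^sub>R e"
proof -
  have ch: "(A$1$1 - l) * (A$2$2 - l) = A$1$2 * A$2$1"
    using assms by (simp add: trace_2 det_2 algebra_simps power2_eq_square)
  have "\<exists>e. e \<noteq> 0 \<and> A *v e = l *\<^sub>R e"
  proof (cases "A$1$2 = 0 \<and> l = A$1$1")
    case False
    let ?e = "vector [A$1$2, l - A$1$1] :: real^2"
    have "?e \<noteq> 0" using False by (simp add: vec_eq_iff forall_2)
    moreover have "A *v ?e = l *\<^sub>R ?e"
      using ch by (simp add: vec_eq_iff forall_2 matrix_vector_2 algebra_simps)
    ultimately show ?thesis by blast
  next
    case first: True
    show ?thesis
    proof (cases "A$2$1 = 0 \<and> l = A$2$2")
      case False
      let ?e = "vector [l - A$2$2, A$2$1] :: real^2"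
      have "?e \<noteq> 0" using False by (auto simp: vec_eq_iff forall_2)
      moreover have "A *v ?e = l *\<^sub>R ?e"
        using ch first by (simp add: vec_eq_iff forall_2 matrix_vector_2 algebra_simps)
      ultimately show ?thesis by blast
    next
      case True
      let ?e = "vector [1, 0] :: real^2"
      have "?e \<noteq> 0" by (simp add: vec_eq_iff forall_2)
      moreover have "A *v ?e = l *\<^sub>R ?e"
        using True first by (simp add: vec_eq_iff forall_2 matrix_vector_2)
      ultimately show ?thesis by blast
    qed
  qed
  with that show ?thesis by blast
qed

lemma preserves_coneI:
  assumes "0 < p" "0 < q" "0 < r" "0 < s" "A *v x = p *\<^sub>R x + r *\<^sub>R y" "A *v y = q *\<^sub>R x + s *\<^sub>R y"
  shows "preserves_cone x y A"
  using assms unfolding preserves_cone_def by blast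

text \<open>The cone spanned by \<open>e\<close> and \<open>f\<close> is widened beyond \<open>e\<close> by \<open>s\<close> and beyond \<open>f\<close> by \<open>t\<close>. The four
  inequalities say that the coordinates of the images of the new generators, with respect to the new
  generators, are positive; the common denominator of these coordinates is \<open>1 - s t\<close>.\<close>

lemma preserves_cone_perturbed:
  assumes "A *v e = p1 *\<^sub>R e + q1 *\<^sub>R f" "A *v f = p2 *\<^sub>R e + q2 *\<^sub>R f" "s * t < 1"
    and pos: "p1 - s * p2 + t * (q1 - s * q2) > 0" "q1 - s * q2 + s * (p1 - s * p2) > 0"
      "p2 - t * p1 + t * (q2 - t * q1) > 0" "q2 - t * q1 + s * (p2 - t * p1) > 0"
  shows "preserves_cone (e - s *\<^sub>R f) (f - t *\<^sub>R e) A"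
proof -
  define D where "D = 1 - s * t"
  have D: "D > 0" using assms(3) by (simp add: D_def)
  have split: "p *\<^sub>R e + q *\<^sub>R f = ((p + t * q) / D) *\<^sub>R (e - s *\<^sub>R f) + ((q + s * p) / D) *\<^sub>R (f - t *\<^sub>R e)"
    for p q
  proof -
    have "(p + t * q) / D - t * ((q + s * p) / D) = ((p + t * q) - t * (q + s * p)) / D"
      "(q + s * p) / D - s * ((p + t * q) / D) = ((q + s * p) - s * (p + t * q)) / D"
      by (simp_all add: diff_divide_distrib)
    moreover have "(p + t * q) - t * (q + s * p) = p * D" "(q + s * p) - s * (p + t * q) = q * D"
      by (simp_all add: D_def algebra_simps)
    ultimately have "(p + t * q) / D - t * ((q + s * p) / D) = p"
      "(q + s * p) / D - s * ((p + t * q) / D) = q"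
      using D by simp_all
    then have "p *\<^sub>R e + q *\<^sub>R f = ((p + t * q) / D - t * ((q + s * p) / D)) *\<^sub>R e
        + ((q + s * p) / D - s * ((p + t * q) / D)) *\<^sub>R f" by simp
    also have "\<dots> = ((p + t * q) / D) *\<^sub>R (e - s *\<^sub>R f) + ((q + s * p) / D) *\<^sub>R (f - t *\<^sub>R e)"
      by (simp add: scaleR_diff_left scaleR_diff_right mult.commute)
    finally show ?thesis .
  qed
  have "A *v (e - s *\<^sub>R f) = (p1 - s * p2) *\<^sub>R e + (q1 - s * q2) *\<^sub>R f"
    "A *v (f - t *\<^sub>R e) = (p2 - t * p1) *\<^sub>R e + (q2 - t * q1) *\<^sub>R f"
    by (simp_all add: matrix_vector_mult_diff_distrib matrix_vector_mult_scaleR assms(1,2) algebra_simps)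
  note image = this[unfolded split[of "p1 - s * p2"] split[of "p2 - t * p1"]]
  show ?thesis using pos D by (intro preserves_coneI[OF _ _ _ _ image]) simp_all
qed

lemma wedge_perturbed: "wedge (e - s *\<^sub>R f) (f - t *\<^sub>R e) = (1 - s * t) * wedge e f"
  using wedge_anticommute[of f e] by (simp add: wedge_simps algebra_simps)

lemma eventually_at_right_pos:
  fixes h :: "real \<Rightarrow> real"
  assumes "isCont h 0" "h 0 > 0"
  shows "\<forall>\<^sub>F s in at_right 0. h s > 0"
proof -
  have "(h \<longlongrightarrow> h 0) (at_right 0)"
    using assms(1) by (simp add: isCont_def filterlim_at_split)
  then show ?thesis using assms(2) order_tendstoD(1) by blast
qed

text \<open>A common attracting line has arbitrarily thin cones around it that are contracted by both
  matrices. In such a cone the off-diagonal entry \<open>b\<close> is only felt to first order in the width.\<close>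

lemma common_cone_eigenvector:
  assumes "e \<noteq> 0" "A *v e = k *\<^sub>R e" "B *v e = l *\<^sub>R e" "k > 1" "l > 1"
    and "\<bar>det A\<bar> = 1" "\<bar>det B\<bar> = 1"
  shows "common_cone A B"
proof -
  define g :: "real^2" where "g = vector [- e$2, e$1]"
  have w: "wedge e g \<noteq> 0"
  proof -
    have "wedge e g = (e$1)\<^sup>2 + (e$2)\<^sup>2" by (simp add: wedge_def g_def power2_eq_square)
    moreover have "e$1 \<noteq> 0 \<or> e$2 \<noteq> 0" using assms(1) by (auto simp: vec_eq_iff forall_2)
    ultimately show ?thesis by (auto simp: sum_power2_eq_zero_iff)
  qed
  have *: "\<forall>\<^sub>F s in at_right 0. preserves_cone (e + s *\<^sub>R g) (e - s *\<^sub>R g) M"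
    if M: "M *v e = m *\<^sub>R e" "m > 1" "\<bar>det M\<bar> = 1" for M m
  proof -
    obtain b d where Mg: "M *v g = b *\<^sub>R e + d *\<^sub>R g" by (rule basis_coordinates[OF w])
    have "det M = m * d" using basis_trace_det(2)[OF w, of M m 0 b d] M(1) Mg by simp
    then have "\<bar>d\<bar> * m = 1" using M(2,3) by (simp add: abs_mult mult.commute)
    then have "\<bar>d\<bar> = 1 / m" "1 / m < m" using M(2) by (simp_all add: field_simps less_1_mult)
    then have "\<bar>d\<bar> < m" by simp
    then have d: "d < m" "- d < m" by auto
    have "\<forall>\<^sub>F s in at_right 0. m + b * s + d > 0" "\<forall>\<^sub>F s in at_right 0. m + b * s - d > 0"
      "\<forall>\<^sub>F s in at_right 0. m - b * s + d > 0" "\<forall>\<^sub>F s in at_right 0. m - b * s - d > 0"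
      using d by (intro eventually_at_right_pos continuous_intros; simp)+
    then show ?thesis
    proof eventually_elim
      case (elim s)
      have "M *v (e + s *\<^sub>R g) = (m + b * s) *\<^sub>R e + (s * d) *\<^sub>R g"
        "M *v (e - s *\<^sub>R g) = (m - b * s) *\<^sub>R e - (s * d) *\<^sub>R g"
        by (simp_all add: matrix_vector_right_distrib matrix_vector_mult_diff_distrib
            matrix_vector_mult_scaleR M Mg algebra_simps)
      moreover have "(m + b * s) *\<^sub>R e + (s * d) *\<^sub>R g =
          ((m + b * s + d) / 2) *\<^sub>R (e + s *\<^sub>R g) + ((m + b * s - d) / 2) *\<^sub>R (e - s *\<^sub>R g)"
        "(m - b * s) *\<^sub>R e - (s * d) *\<^sub>R g =
          ((m - b * s - d) / 2) *\<^sub>R (e + s *\<^sub>R g) + ((m - b * s + d) / 2) *\<^sub>R (e - s *\<^sub>R g)"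
        by (simp_all add: vec_eq_iff field_simps)
      ultimately have image: "M *v (e + s *\<^sub>R g) =
          ((m + b * s + d) / 2) *\<^sub>R (e + s *\<^sub>R g) + ((m + b * s - d) / 2) *\<^sub>R (e - s *\<^sub>R g)"
        "M *v (e - s *\<^sub>R g) =
          ((m - b * s - d) / 2) *\<^sub>R (e + s *\<^sub>R g) + ((m - b * s + d) / 2) *\<^sub>R (e - s *\<^sub>R g)"
        by simp_all
      show ?case using elim by (intro preserves_coneI[OF _ _ _ _ image]) simp_all
    qed
  qed
  have "\<forall>\<^sub>F s in at_right 0. preserves_cone (e + s *\<^sub>R g) (e - s *\<^sub>R g) A \<and>
      preserves_cone (e + s *\<^sub>R g) (e - s *\<^sub>R g) B \<and> s > 0"
    using assms * by (intro eventually_conj) (auto simp: eventually_at_right_less)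
  then obtain s where s: "preserves_cone (e + s *\<^sub>R g) (e - s *\<^sub>R g) A"
      "preserves_cone (e + s *\<^sub>R g) (e - s *\<^sub>R g) B" "s > 0"
    using eventually_happens[of _ "at_right (0::real)"] by auto
  moreover have "wedge (e + s *\<^sub>R g) (e - s *\<^sub>R g) = - 2 * s * wedge e g"
    using wedge_anticommute[of g e] by (simp add: wedge_simps)
  ultimately show ?thesis unfolding common_cone_def using w
    by (intro exI[of _ "e + s *\<^sub>R g"] exI[of _ "e - s *\<^sub>R g"]) auto
qed

text \<open>The attracting eigenvalue, for either sign of the determinant \<open>d\<close>.\<close>

lemma loxodromic_eigenvalue:
  fixes t d :: real
  assumes "\<bar>d\<bar> = 1" "t > 0" "d = 1 \<Longrightarrow> t > 2"
  obtains l where "l > 1" "l\<^sup>2 - t * l + d = 0" "t = l + d / l"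
proof -
  define D where "D = t\<^sup>2 - 4 * d"
  define l where "l = (t + sqrt D) / 2"
  have "d = 1 \<or> d = -1" using assms(1) by auto
  then have D: "D \<ge> 0 \<and> l > 1"
  proof
    assume d: "d = 1"
    then have "D = (t - 2) * (t + 2)" by (simp add: D_def power2_eq_square algebra_simps)
    then have "D > 0" using assms(3)[OF d] by simp
    have "2 + 0 < t + sqrt D" using \<open>D > 0\<close> by (intro add_strict_mono assms(3)[OF d]) simp
    then show "D \<ge> 0 \<and> l > 1" using \<open>D > 0\<close> by (simp_all add: l_def)
  next
    assume d: "d = -1"
    then have "D > 2\<^sup>2" using assms(2) by (simp add: D_def)
    then have "sqrt D > 2" by (rule real_less_rsqrt)
    then show "D \<ge> 0 \<and> l > 1" using assms(2) \<open>D > 2\<^sup>2\<close> by (auto simp: l_def)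
  qed
  have "(2 * l - t)\<^sup>2 = D" using D by (simp add: l_def field_simps)
  then have root: "l\<^sup>2 - t * l + d = 0" by (simp add: D_def power2_eq_square algebra_simps)
  moreover have "t = l + d / l" using root D by (simp add: field_simps power2_eq_square)
  ultimately show ?thesis using D that by blast
qed

text \<open>Here \<open>e\<close> and \<open>f\<close> are attracting eigenvectors, oriented such that the cone between them is the
  right one to look at. If \<open>B\<close> reverses the orientation (\<open>d = -1\<close>), it throws \<open>e\<close> to the far side of
  \<open>f\<close>, so the cone has to be widened beyond \<open>f\<close> by a definite amount \<open>t\<close>. This amount must still be
  small enough for \<open>A\<close> to pull the new generator back inside, which is possible since \<open>b c\<close> is
  large. Beyond \<open>e\<close>, any sufficiently small widening \<open>s\<close> will do.\<close>

lemma common_cone_attracting_vectors: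
  assumes w: "wedge e f \<noteq> 0" and
    A: "A *v e = l *\<^sub>R e" "A *v f = b *\<^sub>R e + (1 / l) *\<^sub>R f" and
    B: "B *v f = m *\<^sub>R f" "B *v e = (d / m) *\<^sub>R e + c *\<^sub>R f" and
    ineq: "l > 1" "m > 1" "\<bar>d\<bar> = 1" "b > 0" "c > 0" "2 * (b * c) \<ge> (l - 1 / l) * (m - d / m)"
  shows "common_cone A B"
proof -
  have l: "l - 1 / l > 0" "1 / l > 0" and m: "m - 1 / m > 0" "1 / m > 0"
    using ineq(1,2) by (simp_all add: field_simps less_1_mult)
  have "d = 1 \<or> d = -1" using ineq(3) by auto
  \<comment> \<open>\<open>u\<close> will be \<open>t c\<close>. The lower bound brings the image of \<open>e\<close> under \<open>B\<close> into the widened cone; the upper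
    bounds keep the images of \<open>f - t e\<close> under \<open>B\<close> and \<open>A\<close> inside.\<close>
  then obtain u where u: "u > 0" "- d / m < u" "u < m" "u < m - d / m" "u * (l - 1 / l) < b * c"
  proof
    assume d: "d = 1"
    have "0 < min (m - 1 / m) (b * c / (l - 1 / l))" using ineq l m by simp
    then obtain u where "0 < u" "u < min (m - 1 / m) (b * c / (l - 1 / l))" using dense by blast
    moreover have "- d / m < 0" using d m by simp
    ultimately have "0 < u" "- d / m < u" "u < m" "u < m - d / m" "u * (l - 1 / l) < b * c"
      using d m l by (simp_all only: min_less_iff_conj pos_less_divide_eq) linarith+
    then show ?thesis by (rule that)
  next
    assume d: "d = -1"
    have "(1 / m) * (l - 1 / l) < b * c"
    proof -
      have "(2 * (1 / m)) * (l - 1 / l) < (m + 1 / m) * (l - 1 / l)"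
        using l m by (intro mult_strict_right_mono) auto
      then have "2 * ((1 / m) * (l - 1 / l)) < 2 * (b * c)"
        using ineq(6) unfolding d minus_divide_left[symmetric] by (simp only: mult_ac) simp
      then show ?thesis by (rule mult_left_less_imp_less) simp
    qed
    then have "1 / m < min m (b * c / (l - 1 / l))" using l m by (simp add: pos_less_divide_eq)
    then obtain u where "1 / m < u" "u < min m (b * c / (l - 1 / l))" using dense by blast
    then have "0 < u" "- d / m < u" "u < m" "u < m - d / m" "u * (l - 1 / l) < b * c"
      using d m l by (simp_all only: min_less_iff_conj pos_less_divide_eq) linarith+
    then show ?thesis by (rule that)
  qed
  define t where "t = u / c"
  have t: "t > 0" "t * c = u" using u(1) ineq(5) by (simp_all add: t_def)
  have "t * (l - 1 / l) * c < b * c" using u(5) unfolding t(2)[symmetric] by (simp add: mult_ac)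
  then have tb: "t * (l - 1 / l) < b" using ineq(5) by simp
  have A': "A *v e = l *\<^sub>R e + 0 *\<^sub>R f" and B': "B *v f = 0 *\<^sub>R e + m *\<^sub>R f" using A B by simp_all
  have "\<forall>\<^sub>F s in at_right 0. 1 - s * t > 0" "\<forall>\<^sub>F s in at_right 0. l - s * b + t * (0 - s * (1 / l)) > 0"
    "\<forall>\<^sub>F s in at_right 0. l - 1 / l - s * b > 0" "\<forall>\<^sub>F s in at_right 0. 1 / l - t * 0 + s * (b - t * l) > 0"
    "\<forall>\<^sub>F s in at_right 0. d / m - s * 0 + t * (c - s * m) > 0"
    "\<forall>\<^sub>F s in at_right 0. c - s * m + s * (d / m - s * 0) > 0"
    "\<forall>\<^sub>F s in at_right 0. m - t * c + s * (0 - t * (d / m)) > 0"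
    using l ineq(1,5) u(2,3) t(2)
    by (intro eventually_at_right_pos continuous_intros; simp)+
  with eventually_at_right_less[of "0::real"] have "\<forall>\<^sub>F s in at_right 0. s * t < 1 \<and> preserves_cone (e - s *\<^sub>R f) (f - t *\<^sub>R e) A \<and>
      preserves_cone (e - s *\<^sub>R f) (f - t *\<^sub>R e) B"
  proof eventually_elim
    case (elim s)
    have st: "s * t < 1" using elim(2) by simp
    have "0 - s * (1 / l) + s * (l - s * b) = s * (l - 1 / l - s * b)" by (simp add: algebra_simps)
    then have 2: "0 - s * (1 / l) + s * (l - s * b) > 0" using elim(1,4) by simp
    have "b - t * l + t * (1 / l - t * 0) = b - t * (l - 1 / l)" by (simp add: algebra_simps)
    then have 3: "b - t * l + t * (1 / l - t * 0) > 0" using tb by simp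
    have "0 - t * (d / m) + t * (m - t * c) = t * (m - d / m - u)" using t(2) by (simp add: algebra_simps)
    then have 7: "0 - t * (d / m) + t * (m - t * c) > 0" using t(1) u(4) by simp
    show ?case
      using preserves_cone_perturbed[OF A' A(2) st elim(3) 2 3 elim(5)]
        preserves_cone_perturbed[OF B(2) B' st elim(6,7) 7 elim(8)] st by blast
  qed
  then obtain s where "s * t < 1" "preserves_cone (e - s *\<^sub>R f) (f - t *\<^sub>R e) A"
      "preserves_cone (e - s *\<^sub>R f) (f - t *\<^sub>R e) B"
    using eventually_happens[of _ "at_right (0::real)"] by auto
  moreover have "wedge (e - s *\<^sub>R f) (f - t *\<^sub>R e) \<noteq> 0"
    using w \<open>s * t < 1\<close> by (simp add: wedge_perturbed)
  ultimately show ?thesis unfolding common_cone_def by blast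
qed

text \<open>Two orientation-reversing matrices that preserve a cone have a hyperbolic product, and this
  necessary condition is sufficient as well. The cone has to contain the attracting lines of
  \<open>B A\<close> and of \<open>A B\<close>. These are spanned by vectors \<open>e\<close> and \<open>f\<close> which the two matrices interchange
  up to a factor, namely \<open>A e = f\<close> and \<open>B f = n e\<close>; in this basis both matrices have nonnegative
  entries. The boundary is pushed into the interior by widening the cone by \<open>x\<close> beyond \<open>e\<close> and by
  \<open>n x\<close> beyond \<open>f\<close>, where any factor strictly between \<open>1\<close> and \<open>n\<^sup>2\<close> could be used instead of \<open>n\<close>.\<close>

lemma common_cone_both_reversing:
  assumes det: "det A = -1" "det B = -1" and tr: "trace A > 0" "trace B > 0" "trace (A ** B) > 2"
  shows "common_cone A B"
proof -
  have "det (B ** A) = 1" "trace (B ** A) > 2"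
    using det tr by (simp_all add: det_mul trace_mul_sym[of B A])
  then obtain n where n: "n > 1" "n\<^sup>2 - trace (B ** A) * n + det (B ** A) = 0"
      "trace (B ** A) = n + 1 / n"
    using loxodromic_eigenvalue[of 1 "trace (B ** A)"] by auto
  obtain e where e: "e \<noteq> 0" "(B ** A) *v e = n *\<^sub>R e" using eigenvector_exists[OF n(2)] by blast
  define f where "f = A *v e"
  have Bf: "B *v f = n *\<^sub>R e" using e(2) by (simp add: f_def matrix_vector_mul_assoc)
  show ?thesis
  proof (cases "wedge e f = 0")
    case True
    then obtain k where k: "A *v e = k *\<^sub>R e" using wedge_eq_0D[OF _ e(1)] f_def by metis
    have k0: "k \<noteq> 0" using Bf k n e(1) by (auto simp: f_def)
    define k' where "k' = n / k"
    have "k *\<^sub>R (B *v e) = n *\<^sub>R e" using Bf k by (simp add: f_def matrix_vector_mult_scaleR)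
    then have "(1 / k) *\<^sub>R (k *\<^sub>R (B *v e)) = (1 / k) *\<^sub>R (n *\<^sub>R e)" by simp
    then have k': "B *v e = k' *\<^sub>R e" using k0 by (simp add: k'_def)
    have char: "r\<^sup>2 - 1 = trace M * r" if "M *v e = r *\<^sub>R e" "det M = -1" for M r
    proof -
      obtain g where g: "wedge e g \<noteq> 0"
      proof -
        have "\<exists>g. wedge e g \<noteq> 0"
        proof (rule ccontr)
          assume "\<not> ?thesis"
          then have "wedge e (vector [0, 1]) = 0" "wedge e (vector [1, 0]) = 0" by auto
          then show False using e(1) by (simp add: wedge_def vec_eq_iff forall_2)
        qed
        then show ?thesis using that by blast
      qed
      obtain b d where Mg: "M *v g = b *\<^sub>R e + d *\<^sub>R g" by (rule basis_coordinates[OF g])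
      have "trace M = r + d" "det M = r * d"
        using basis_trace_det[OF g, of M r 0 b d] that Mg by simp_all
      then show ?thesis using that(2) by (simp add: algebra_simps power2_eq_square)
    qed
    have ck: "k\<^sup>2 - 1 = trace A * k" and ck': "k'\<^sup>2 - 1 = trace B * k'"
      using char k k' det by auto
    have kk: "k * k' = n" using k0 by (simp add: k'_def)
    have "k > 0"
    proof (rule ccontr)
      assume "\<not> k > 0"
      then have neg: "k < 0" "k' < 0" using k0 n(1) by (auto simp: k'_def divide_less_0_iff)
      have "trace A * k < 0" "trace B * k' < 0" using neg tr by (simp_all add: mult_pos_neg)
      then have "k\<^sup>2 < 1" "k'\<^sup>2 < 1" using ck ck' by simp_all
      then have "k\<^sup>2 * k'\<^sup>2 < 1 * 1" by (intro mult_strict_mono) auto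
      then have "(k * k')\<^sup>2 < 1" by (simp add: power_mult_distrib)
      then show False using kk n(1) by (simp add: abs_square_less_1)
    qed
    then have pos: "k > 0" "k' > 0" using n(1) by (auto simp: k'_def)
    have "trace A * k > 0" "trace B * k' > 0" using pos tr by simp_all
    then have "k\<^sup>2 > 1" "k'\<^sup>2 > 1" using ck ck' by simp_all
    then have "k > 1" "k' > 1" using pos by (auto simp: power2_eq_square less_1_mult' ) (smt (verit) mult_le_one)+
    then show ?thesis using common_cone_eigenvector[OF e(1) k k'] det by simp
  next
    case w: False
    have Ae: "A *v e = 0 *\<^sub>R e + 1 *\<^sub>R f" by (simp add: f_def)
    obtain p q where Af: "A *v f = p *\<^sub>R e + q *\<^sub>R f" by (rule basis_coordinates[OF w])
    obtain r s where Be: "B *v e = r *\<^sub>R e + s *\<^sub>R f" by (rule basis_coordinates[OF w])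
    have Bf': "B *v f = n *\<^sub>R e + 0 *\<^sub>R f" using Bf by simp
    have "det A = - p" "trace A = q" using basis_trace_det[OF w Ae Af] by simp_all
    then have p: "p = 1" and q: "q > 0" using det tr by auto
    have "det B = - n * s" "trace B = r" using basis_trace_det[OF w Be Bf'] by simp_all
    then have s: "s = 1 / n" and r: "r > 0" using det tr n(1) by (auto simp: field_simps)
    have n0: "1 / n > 0" "n > 0" using n(1) by simp_all
    have "\<forall>\<^sub>F x in at_right 0. 1 - x * (n * x) > 0" "\<forall>\<^sub>F x in at_right 0. n - 1 - n * x * q > 0"
      "\<forall>\<^sub>F x in at_right 0. 1 - x * q + x * (0 - x * 1) > 0"
      "\<forall>\<^sub>F x in at_right 0. 1 - n * x * 0 + n * x * (q - n * x * 1) > 0"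
      "\<forall>\<^sub>F x in at_right 0. q - n * x * 1 + x * (1 - n * x * 0) > 0"
      "\<forall>\<^sub>F x in at_right 0. r - x * n + n * x * (1 / n - x * 0) > 0"
      "\<forall>\<^sub>F x in at_right 0. 1 / n - x * 0 + x * (r - x * n) > 0"
      "\<forall>\<^sub>F x in at_right 0. n - n * x * r + n * x * (0 - n * x * (1 / n)) > 0"
      "\<forall>\<^sub>F x in at_right 0. n - 1 - n * x * r > 0"
      using n(1) n0 q r
      by (intro eventually_at_right_pos continuous_intros; simp)+
    with eventually_at_right_less[of "0::real"] have "\<forall>\<^sub>F x in at_right 0. x * (n * x) < 1 \<and>
        preserves_cone (e - x *\<^sub>R f) (f - (n * x) *\<^sub>R e) A \<and> preserves_cone (e - x *\<^sub>R f) (f - (n * x) *\<^sub>R e) B"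
    proof eventually_elim
      case (elim x)
      have st: "x * (n * x) < 1" using elim(2) by simp
      have "0 - x * 1 + n * x * (1 - x * q) = x * (n - 1 - n * x * q)"
        "0 - n * x * (1 / n) + x * (n - n * x * r) = x * (n - 1 - n * x * r)"
        using n0 by (simp_all add: algebra_simps)
      then have new: "0 - x * 1 + n * x * (1 - x * q) > 0" "0 - n * x * (1 / n) + x * (n - n * x * r) > 0"
        using elim(1,3,10) by simp_all
      show ?case
        using preserves_cone_perturbed[OF Ae Af[unfolded p] st new(1) elim(4,5,6)]
          preserves_cone_perturbed[OF Be[unfolded s] Bf' st elim(7,8,9) new(2)] st by blast
    qed
    then obtain x where "x * (n * x) < 1" "preserves_cone (e - x *\<^sub>R f) (f - (n * x) *\<^sub>R e) A"
        "preserves_cone (e - x *\<^sub>R f) (f - (n * x) *\<^sub>R e) B"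
      using eventually_happens[of _ "at_right (0::real)"] by auto
    moreover have "wedge (e - x *\<^sub>R f) (f - (n * x) *\<^sub>R e) \<noteq> 0"
      using w \<open>x * (n * x) < 1\<close> by (simp add: wedge_perturbed)
    ultimately show ?thesis unfolding common_cone_def by blast
  qed
qed

text \<open>In the basis of attracting eigenvectors, with off-diagonal entries \<open>b\<close> and \<open>c\<close>, the hypothesis on
  the traces turns into \<open>2 b c \<ge> (l - 1/l) (m - d/m)\<close> with \<open>d = det B\<close>. In particular \<open>b\<close> and \<open>c\<close>
  have the same sign, which becomes positive after changing the sign of one eigenvector.\<close>

lemma common_cone_one_preserving:
  assumes det: "det A = 1" "\<bar>det B\<bar> = 1" and trA: "trace A > 2" and
    trB: "trace B > 0" "det B = 1 \<Longrightarrow> trace B > 2" and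
    ineq: "2 * trace (A ** B) \<ge> trace A * trace B"
  shows "common_cone A B"
proof -
  obtain l where l: "l > 1" "l\<^sup>2 - trace A * l + det A = 0" "trace A = l + 1 / l"
    using loxodromic_eigenvalue[of 1 "trace A"] det trA by auto
  obtain m where m: "m > 1" "m\<^sup>2 - trace B * m + det B = 0" "trace B = m + det B / m"
    using loxodromic_eigenvalue[of "det B" "trace B"] det trB by blast
  obtain e where e: "e \<noteq> 0" "A *v e = l *\<^sub>R e" using eigenvector_exists[OF l(2)] by blast
  obtain f where f: "f \<noteq> 0" "B *v f = m *\<^sub>R f" using eigenvector_exists[OF m(2)] by blast
  show ?thesis
  proof (cases "wedge e f = 0")
    case True
    then obtain k where k: "f = k *\<^sub>R e" using wedge_eq_0D[OF _ e(1)] by blast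
    then have "k \<noteq> 0" using f by auto
    have "k *\<^sub>R (B *v e) = k *\<^sub>R (m *\<^sub>R e)" using f(2) k by (simp add: matrix_vector_mult_scaleR mult.commute)
    then have "B *v e = m *\<^sub>R e" using \<open>k \<noteq> 0\<close> by (simp only: scaleR_cancel_left) simp
    then show ?thesis using common_cone_eigenvector[OF e] l(1) m(1) det by simp
  next
    case w: False
    obtain b b' where Af: "A *v f = b *\<^sub>R e + b' *\<^sub>R f" by (rule basis_coordinates[OF w])
    obtain c' c where Be: "B *v e = c' *\<^sub>R e + c *\<^sub>R f" by (rule basis_coordinates[OF w])
    have Ae: "A *v e = l *\<^sub>R e + 0 *\<^sub>R f" and Bf: "B *v f = 0 *\<^sub>R e + m *\<^sub>R f" using e f by simp_all
    have b': "b' = 1 / l" using basis_trace_det(1)[OF w Ae Af] l by simp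
    have c': "c' = det B / m" using basis_trace_det(1)[OF w Be Bf] m by simp
    have "(A ** B) *v e = A *v (B *v e)" "(A ** B) *v f = A *v (B *v f)"
      by (simp_all add: matrix_vector_mul_assoc)
    then have "(A ** B) *v e = (c' * l + c * b) *\<^sub>R e + (c * b') *\<^sub>R f"
      "(A ** B) *v f = (m * b) *\<^sub>R e + (m * b') *\<^sub>R f"
      by (simp_all add: Be f(2) e(2) Af matrix_vector_right_distrib matrix_vector_mult_scaleR algebra_simps)
    then have "trace (A ** B) = c' * l + c * b + m * b'" by (rule basis_trace_det(1)[OF w])
    then have "2 * (b * c) \<ge> (l + 1 / l) * (m + det B / m) - 2 * (l * (det B / m)) - 2 * (m * (1 / l))"
      using ineq unfolding l(3) m(3) b' c' by (simp add: mult_ac)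
    then have bc: "2 * (b * c) \<ge> (l - 1 / l) * (m - det B / m)"
      by (simp add: algebra_simps)
    have "l - 1 / l > 0" using l(1) by (simp add: field_simps less_1_mult)
    moreover have "m - det B / m > 0"
    proof -
      have "det B / m \<le> 1 / m" using det(2) m(1) by (intro divide_right_mono) auto
      moreover have "1 / m < m" using m(1) by (simp add: field_simps less_1_mult)
      ultimately show ?thesis by linarith
    qed
    ultimately have "b * c > 0" using bc mult_pos_pos[of "l - 1 / l" "m - det B / m"] by linarith
    then consider "b > 0" "c > 0" | "- b > 0" "- c > 0" by (auto simp: zero_less_mult_iff)
    then show ?thesis
    proof cases
      case 1
      show ?thesis
        by (rule common_cone_attracting_vectors[OF w e(2) Af[unfolded b'] f(2) Be[unfolded c'] l(1) m(1) det(2) 1 bc])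
    next
      case 2
      have w': "wedge e (- f) \<noteq> 0" using w by (simp add: wedge_simps)
      have neg: "M *v (- f) = - (M *v f)" for M :: "real^2^2"
        using matrix_vector_mult_scaleR[of M "-1" f] by simp
      have "A *v (- f) = (- b) *\<^sub>R e + (1 / l) *\<^sub>R (- f)" "B *v (- f) = m *\<^sub>R (- f)"
        "B *v e = (det B / m) *\<^sub>R e + (- c) *\<^sub>R (- f)"
        using Af b' f(2) Be c' by (simp_all add: neg)
      moreover have "2 * (- b * - c) \<ge> (l - 1 / l) * (m - det B / m)" using bc by simp
      ultimately show ?thesis
        using common_cone_attracting_vectors[OF w' e(2)] l(1) m(1) det(2) 2 by blast
    qed
  qed
qed

text \<open>The trace inequality says that the directions of translation form at most a right angle if the axes
  cross, and that they are not opposite if the axes are disjoint. For two glide reflections it is not enough: if their axes cross at a right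
  angle and their translations are short, then the product is elliptic.\<close>

lemma common_cone_criterion:
  assumes det: "\<bar>det A\<bar> = 1" "\<bar>det B\<bar> = 1" and
    tr: "trace A > 0" "trace B > 0" "det A = 1 \<Longrightarrow> trace A > 2" "det B = 1 \<Longrightarrow> trace B > 2" and
    ineq: "2 * trace (A ** B) \<ge> trace A * trace B" and
    prod: "det A = -1 \<Longrightarrow> det B = -1 \<Longrightarrow> trace (A ** B) > 2"
  shows "common_cone A B"
proof -
  have d: "det A = 1 \<or> det A = -1" "det B = 1 \<or> det B = -1" using det by auto
  then consider "det A = 1" | "det B = 1" | "det A = -1" "det B = -1" by blast
  then show ?thesis
  proof cases
    case 1 then show ?thesis using common_cone_one_preserving[of A B] assms by simp
  next
    case 2
    have "2 * trace (B ** A) \<ge> trace B * trace A" using ineq by (simp add: trace_mul_sym[of B A] mult.commute)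
    then show ?thesis using 2 common_cone_one_preserving[of B A] assms common_cone_commute by simp
  next
    case 3 then show ?thesis using common_cone_both_reversing tr prod by simp
  qed
qed

section \<open>Singular values and powers of matrices\<close>

lemma norm_matrix_vector_le: "norm (A *v x) \<le> norm A * norm (x :: real^'n)" for A :: "real^'n^'m"
proof -
  have "norm (A *v x) = L2_set (\<lambda>i. \<bar>inner (A$i) x\<bar>) UNIV"
    by (simp add: norm_vec_def matrix_vector_mul_component)
  also have "\<dots> \<le> L2_set (\<lambda>i. norm (A$i) * norm x) UNIV"
    by (intro L2_set_mono Cauchy_Schwarz_ineq2) simp
  also have "\<dots> = norm A * norm x" by (simp add: L2_set_left_distrib norm_vec_def)
  finally show ?thesis .
qed

lemma abs_wedge_le: "\<bar>wedge x y\<bar> \<le> norm x * norm y"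
proof -
  let ?z = "vector [y$2, - y$1] :: real^2"
  have "wedge x y = inner x ?z" by (simp add: wedge_def inner_vec_def sum_2)
  moreover have "norm ?z = norm y" by (simp add: norm_vec_def L2_set_def sum_2 add.commute)
  ultimately show ?thesis using Cauchy_Schwarz_ineq2[of x ?z] by simp
qed

text \<open>A matrix of determinant \<open>\<plusminus>1\<close> and its inverse have the same norm. The proof compares areas of the
  square over \<open>x\<close> and of its image, a parallelogram.\<close>

lemma norm_le_norm_image:
  fixes x :: "real^2"
  assumes "\<bar>det A\<bar> = 1"
  shows "norm x \<le> norm A * norm (A *v x)"
proof (cases "x = 0")
  case False
  let ?y = "vector [- (x$2), x$1] :: real^2"
  have w: "wedge x ?y = (norm x)\<^sup>2"
    unfolding power2_norm_eq_inner by (simp add: wedge_def inner_vec_def sum_2)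
  have y: "norm ?y = norm x" by (simp add: norm_vec_def L2_set_def sum_2 add.commute)
  have "(norm x)\<^sup>2 = \<bar>wedge (A *v x) (A *v ?y)\<bar>" using assms by (simp add: det_wedge w abs_mult)
  also have "\<dots> \<le> norm (A *v x) * norm (A *v ?y)" by (rule abs_wedge_le)
  also have "\<dots> \<le> norm (A *v x) * (norm A * norm x)"
    using norm_matrix_vector_le[of A ?y] y by (intro mult_left_mono) auto
  finally have "norm x * norm x \<le> (norm A * norm (A *v x)) * norm x"
    by (simp add: power2_eq_square mult_ac)
  then show ?thesis using False by simp
qed simp

lemma inner_product_equivalent_norm:
  assumes "inner_product ip"
  obtains c C where "c > 0" "C > 0" "\<And>x. c * (norm x)\<^sup>2 \<le> ip x x" "\<And>x. ip x x \<le> C * (norm x)\<^sup>2"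
proof -
  have bil: "bilinear ip" and pos: "\<And>x. x \<noteq> 0 \<Longrightarrow> ip x x > 0"
    using assms by (auto simp: inner_product_def)
  then interpret bounded_bilinear ip by (simp add: bilinear_conv_bounded_bilinear)
  obtain C where C: "C > 0" "\<And>x y. norm (ip x y) \<le> norm x * norm y * C"
    using pos_bounded by blast
  have "\<exists>u\<in>sphere 0 1. \<forall>y\<in>sphere 0 1. ip u u \<le> ip y y"
  proof (rule continuous_attains_inf)
    show "compact (sphere (0 :: real^2) 1)" by simp
    have "axis 1 1 \<in> sphere (0 :: real^2) 1" by simp
    then show "sphere (0 :: real^2) 1 \<noteq> {}" by blast
    show "continuous_on (sphere 0 1) (\<lambda>x. ip x x)" by (intro continuous_on continuous_on_id)
  qed
  then obtain u where u: "norm u = 1" "\<And>y. norm y = 1 \<Longrightarrow> ip u u \<le> ip y y" by auto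
  have "ip u u * (norm x)\<^sup>2 \<le> ip x x" for x
  proof (cases "x = 0")
    case False
    let ?y = "(1 / norm x) *\<^sub>R x"
    have "ip u u \<le> ip ?y ?y" using False by (intro u) simp
    also have "\<dots> = ip x x / (norm x)\<^sup>2" by (simp add: scaleR_left scaleR_right power2_eq_square)
    finally show ?thesis using False by (simp add: pos_le_divide_eq)
  qed (simp add: zero_left)
  moreover have "ip x x \<le> C * (norm x)\<^sup>2" for x
    using C(2)[of x x] by (simp add: power2_eq_square mult_ac abs_le_iff)
  moreover have "ip u u > 0" using u(1) by (intro pos) auto
  ultimately show ?thesis using C(1) that by blast
qed

lemma orthonormal_basis_exists:
  assumes "inner_product ip"
  obtains e f where "ip e e = 1" "ip f f = 1" "ip e f = 0" "wedge e f \<noteq> 0"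
proof -
  have bil: "bilinear ip" and sym: "\<And>x y. ip x y = ip y x" and pos: "\<And>x. x \<noteq> 0 \<Longrightarrow> ip x x > 0"
    using assms by (auto simp: inner_product_def)
  define a :: "real^2" where "a = vector [1, 0]"
  define b :: "real^2" where "b = vector [0, 1]"
  define b' where "b' = b - (ip a b / ip a a) *\<^sub>R a"
  have wab: "wedge a b = 1" by (simp add: wedge_def a_def b_def)
  then have wab': "wedge a b' = 1" by (simp add: b'_def wedge_simps)
  then have nz: "ip a a > 0" "ip b' b' > 0" by (intro pos; auto simp: wedge_def)+
  have orth: "ip a b' = 0" using nz by (simp add: b'_def bilinear_rsub[OF bil] bilinear_rmul[OF bil])
  define e where "e = (1 / sqrt (ip a a)) *\<^sub>R a"
  define f where "f = (1 / sqrt (ip b' b')) *\<^sub>R b'"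
  have "ip e e = 1" "ip f f = 1" "ip e f = 0"
    using nz orth by (simp_all add: e_def f_def bilinear_rmul[OF bil] bilinear_lmul[OF bil])
  moreover have "wedge e f \<noteq> 0" using nz wab' by (simp add: e_def f_def wedge_simps)
  ultimately show ?thesis using that by blast
qed

text \<open>In an orthonormal basis, \<open>A\<^sup>* A\<close> is a symmetric matrix with entries \<open>a, b, b, d\<close>. The squares of
  the singular values are the roots of its characteristic polynomial, whose discriminant \<open>T\<^sup>2\<close> is
  a sum of squares.\<close>

lemma singular_values_finite_nonempty:
  assumes "inner_product ip"
  shows "finite (singular_values ip A)" "singular_values ip A \<noteq> {}"
proof -
  have bil: "bilinear ip" and sym: "\<And>x y. ip x y = ip y x" and pos: "\<And>x. x \<noteq> 0 \<Longrightarrow> ip x x > 0"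
    using assms by (auto simp: inner_product_def)
  have nonneg: "ip x x \<ge> 0" for x
    using pos[of x] bilinear_lzero[OF bil, of 0] by (cases "x = 0") auto
  note bil_simps = bilinear_ladd[OF bil] bilinear_radd[OF bil] bilinear_lmul[OF bil] bilinear_rmul[OF bil]
  obtain e f where ef: "ip e e = 1" "ip f f = 1" "ip e f = 0" "wedge e f \<noteq> 0"
    by (rule orthonormal_basis_exists[OF assms])
  define a b d where "a = ip (A *v e) (A *v e)" "b = ip (A *v e) (A *v f)" "d = ip (A *v f) (A *v f)"
  note abd = this
  define T where "T = sqrt ((a - d)\<^sup>2 + 4 * b\<^sup>2)"
  have T: "T\<^sup>2 = (a - d)\<^sup>2 + 4 * b\<^sup>2" by (simp add: T_def)
  have eigen: "(\<forall>y. ip (A *v (u *\<^sub>R e + v *\<^sub>R f)) (A *v y) = t * ip (u *\<^sub>R e + v *\<^sub>R f) y)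
      \<longleftrightarrow> a * u + b * v = t * u \<and> b * u + d * v = t * v" for u v t
  proof
    assume L: "\<forall>y. ip (A *v (u *\<^sub>R e + v *\<^sub>R f)) (A *v y) = t * ip (u *\<^sub>R e + v *\<^sub>R f) y"
    show "a * u + b * v = t * u \<and> b * u + d * v = t * v"
      using L[rule_format, of e] L[rule_format, of f]
      by (simp add: matrix_vector_right_distrib matrix_vector_mult_scaleR bil_simps ef sym[of f e]
          sym[of "A *v f" "A *v e"] abd algebra_simps)
  next
    assume R: "a * u + b * v = t * u \<and> b * u + d * v = t * v"
    show "\<forall>y. ip (A *v (u *\<^sub>R e + v *\<^sub>R f)) (A *v y) = t * ip (u *\<^sub>R e + v *\<^sub>R f) y"
    proof
      fix y
      obtain p q where y: "y = p *\<^sub>R e + q *\<^sub>R f" by (rule basis_coordinates[OF ef(4)])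
      have "ip (A *v (u *\<^sub>R e + v *\<^sub>R f)) (A *v y) = p * (a * u + b * v) + q * (b * u + d * v)"
        by (simp add: y matrix_vector_right_distrib matrix_vector_mult_scaleR bil_simps
            sym[of "A *v f" "A *v e"] abd algebra_simps)
      also have "\<dots> = t * ip (u *\<^sub>R e + v *\<^sub>R f) y"
        using R by (simp add: y bil_simps ef sym[of f e] algebra_simps)
      finally show "ip (A *v (u *\<^sub>R e + v *\<^sub>R f)) (A *v y) = t * ip (u *\<^sub>R e + v *\<^sub>R f) y" .
    qed
  qed
  have "singular_values ip A \<subseteq> sqrt ` {(a + d + T) / 2, (a + d - T) / 2}"
  proof
    fix s assume "s \<in> singular_values ip A"
    then obtain x where s: "s \<ge> 0" and x: "x \<noteq> 0" "\<forall>y. ip (A *v x) (A *v y) = s\<^sup>2 * ip x y"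
      by (auto simp: singular_values_def)
    obtain u v where uv: "x = u *\<^sub>R e + v *\<^sub>R f" by (rule basis_coordinates[OF ef(4)])
    define t where "t = s\<^sup>2"
    have eq: "(a - t) * u = - (b * v)" "(d - t) * v = - (b * u)"
      using x(2) unfolding uv eigen t_def[symmetric] by (simp_all add: algebra_simps)
    have "(a - t) * (d - t) * u = b\<^sup>2 * u" "(a - t) * (d - t) * v = b\<^sup>2 * v"
    proof -
      have "(a - t) * (d - t) * u = (d - t) * ((a - t) * u)" by simp
      also have "\<dots> = - b * ((d - t) * v)" unfolding eq(1) by simp
      also have "\<dots> = b\<^sup>2 * u" unfolding eq(2) by (simp add: power2_eq_square)
      finally show "(a - t) * (d - t) * u = b\<^sup>2 * u" .
      have "(a - t) * (d - t) * v = (a - t) * ((d - t) * v)" by simp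
      also have "\<dots> = - b * ((a - t) * u)" unfolding eq(2) by simp
      also have "\<dots> = b\<^sup>2 * v" unfolding eq(1) by (simp add: power2_eq_square)
      finally show "(a - t) * (d - t) * v = b\<^sup>2 * v" .
    qed
    moreover have "u \<noteq> 0 \<or> v \<noteq> 0" using x(1) uv by auto
    ultimately have "(a - t) * (d - t) = b\<^sup>2" by auto
    then have "(2 * t - (a + d))\<^sup>2 = T\<^sup>2"
      unfolding T by (simp add: power2_eq_square algebra_simps)
    then have "2 * t - (a + d) = T \<or> 2 * t - (a + d) = - T" by (simp add: power2_eq_iff)
    then have "t \<in> {(a + d + T) / 2, (a + d - T) / 2}" by auto
    moreover have "s = sqrt t" using s by (simp add: t_def)
    ultimately show "s \<in> sqrt ` {(a + d + T) / 2, (a + d - T) / 2}" by blast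
  qed
  then show "finite (singular_values ip A)" by (rule finite_subset) simp
  define t where "t = (a + d + T) / 2"
  have "a \<ge> 0" "d \<ge> 0" "T \<ge> 0" by (simp_all add: abd nonneg T_def)
  then have t0: "t \<ge> 0" by (simp add: t_def)
  have "(2 * t - (a + d))\<^sup>2 = T\<^sup>2" by (simp add: t_def field_simps)
  then have tt: "(t - a) * (t - d) = b * b"
    unfolding T by (simp add: power2_eq_square algebra_simps)
  have "\<exists>u v. (u \<noteq> 0 \<or> v \<noteq> 0) \<and> a * u + b * v = t * u \<and> b * u + d * v = t * v"
  proof (cases "b = 0 \<and> t = a")
    case True
    then show ?thesis by (intro exI[of _ 1] exI[of _ 0]) simp
  next
    case False
    then show ?thesis using tt by (intro exI[of _ b] exI[of _ "t - a"]) (auto simp: algebra_simps)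
  qed
  then obtain u v where uv: "u \<noteq> 0 \<or> v \<noteq> 0" "a * u + b * v = t * u \<and> b * u + d * v = t * v" by blast
  have "u *\<^sub>R e + v *\<^sub>R f \<noteq> 0"
  proof
    assume "u *\<^sub>R e + v *\<^sub>R f = 0"
    then have "wedge (u *\<^sub>R e + v *\<^sub>R f) f = 0" "wedge e (u *\<^sub>R e + v *\<^sub>R f) = 0" by (simp_all add: wedge_def)
    then show False using uv(1) ef(4) by (simp add: wedge_simps)
  qed
  moreover note uv(2)[folded eigen]
  ultimately have "sqrt t \<in> singular_values ip A"
    using t0 unfolding singular_values_def by (auto intro!: exI[of _ "u *\<^sub>R e + v *\<^sub>R f"])
  then show "singular_values ip A \<noteq> {}" by blast
qed

lemma singular_values_bounds:
  assumes "inner_product ip"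
  obtains K where "K > 0"
    "\<And>A s. \<bar>det A\<bar> = 1 \<Longrightarrow> s \<in> singular_values ip A \<Longrightarrow> s \<le> K * norm A \<and> 1 \<le> K * norm A * s"
proof -
  obtain c C where cC: "c > 0" "C > 0" "\<And>x. c * (norm x)\<^sup>2 \<le> ip x x" "\<And>x. ip x x \<le> C * (norm x)\<^sup>2"
    using inner_product_equivalent_norm[OF assms] by metis
  define K where "K = sqrt (C / c)"
  have K: "K > 0" "K\<^sup>2 = C / c" using cC(1,2) by (simp_all add: K_def)
  have "s \<le> K * norm A \<and> 1 \<le> K * norm A * s" if A: "\<bar>det A\<bar> = 1" and s: "s \<in> singular_values ip A" for A s
  proof -
    obtain x where x: "x \<noteq> 0" and eq: "ip (A *v x) (A *v x) = s\<^sup>2 * ip x x" and s0: "s \<ge> 0"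
      using s by (auto simp: singular_values_def)
    have nx: "(norm x)\<^sup>2 > 0" using x by simp
    have "s\<^sup>2 * (c * (norm x)\<^sup>2) \<le> s\<^sup>2 * ip x x" using cC by (intro mult_left_mono) auto
    also have "\<dots> \<le> C * (norm (A *v x))\<^sup>2" unfolding eq[symmetric] by (rule cC)
    also have "\<dots> \<le> C * (norm A * norm x)\<^sup>2"
      using cC(2) norm_matrix_vector_le by (intro mult_left_mono power_mono) auto
    finally have "(s\<^sup>2 * c) * (norm x)\<^sup>2 \<le> (C * (norm A)\<^sup>2) * (norm x)\<^sup>2"
      by (simp add: power_mult_distrib mult_ac)
    then have "s\<^sup>2 * c \<le> C * (norm A)\<^sup>2" using nx by simp
    then have "s\<^sup>2 \<le> (K * norm A)\<^sup>2" using cC(1) by (simp add: power_mult_distrib K(2) pos_le_divide_eq)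
    moreover have KA: "K * norm A \<ge> 0" using K(1) by simp
    ultimately have 1: "s \<le> K * norm A" by (rule power2_le_imp_le)
    have "c * (norm x)\<^sup>2 \<le> c * (norm A * norm (A *v x))\<^sup>2"
      using cC(1) norm_le_norm_image[OF A] by (intro mult_left_mono power_mono) auto
    also have "\<dots> = (norm A)\<^sup>2 * (c * (norm (A *v x))\<^sup>2)" by (simp add: power_mult_distrib)
    also have "\<dots> \<le> (norm A)\<^sup>2 * ip (A *v x) (A *v x)" using cC by (intro mult_left_mono) auto
    also have "\<dots> \<le> (norm A)\<^sup>2 * (s\<^sup>2 * (C * (norm x)\<^sup>2))"
      unfolding eq using cC by (intro mult_left_mono) auto
    finally have "c * (norm x)\<^sup>2 \<le> ((norm A)\<^sup>2 * s\<^sup>2 * C) * (norm x)\<^sup>2" by (simp add: mult_ac)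
    then have "c \<le> (norm A)\<^sup>2 * s\<^sup>2 * C" using nx by simp
    then have "1\<^sup>2 \<le> (K * norm A * s)\<^sup>2"
      using cC(1) by (simp add: power_mult_distrib K(2) pos_le_divide_eq mult_ac)
    then have "1 \<le> K * norm A * s" by (rule power2_le_imp_le) (intro mult_nonneg_nonneg KA s0)
    with 1 show ?thesis by blast
  qed
  then show ?thesis using K(1) that by blast
qed

lemma det_scaleR_2: "det (c *\<^sub>R A) = c\<^sup>2 * det (A :: real^2^2)"
  by (simp add: det_2 power2_eq_square algebra_simps)

lemma proj_normalized:
  assumes "\<bar>det A\<bar> = 1" "B \<in> proj A" "\<bar>det B\<bar> = 1"
  shows "B = A \<or> B = - A"
proof -
  obtain c where c: "B = c *\<^sub>R A" using assms(2) by (auto simp: proj_def)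
  then have "c\<^sup>2 = 1" using assms(1,3) by (simp add: det_scaleR_2 abs_mult)
  then have "c = 1 \<or> c = -1" by (simp add: power2_eq_1_iff)
  then show ?thesis using c by auto
qed

text \<open>The matrix selected in the definition of \<open>alpha_mu\<close> is \<open>A\<close> or \<open>-A\<close>, and these have the same
  singular values.\<close>

lemma alpha_mu_proj:
  assumes ip: "inner_product ip" and A: "\<bar>det A\<bar> = 1"
  shows "alpha_mu ip (proj A) = ln (Max (singular_values ip A)) - ln (Min (singular_values ip A))"
proof -
  define B where "B = (SOME B. B \<in> proj A \<and> \<bar>det B\<bar> = 1)"
  have "A \<in> proj A" by (auto simp: proj_def intro: exI[of _ "1::real"])
  then have "B \<in> proj A \<and> \<bar>det B\<bar> = 1" unfolding B_def using A by (metis (mono_tags, lifting) someI_ex)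
  then have "B = A \<or> B = - A" using proj_normalized A by blast
  moreover have "singular_values ip (- A) = singular_values ip A"
  proof -
    have bil: "bilinear ip" using ip by (simp add: inner_product_def)
    have "(- A) *v x = - (A *v x)" for x using scaleR_matrix_vector[of "-1" A x] by simp
    then show ?thesis
      by (simp add: singular_values_def bilinear_lneg[OF bil] bilinear_rneg[OF bil])
  qed
  ultimately have "singular_values ip B = singular_values ip A" by auto
  then show ?thesis by (simp add: alpha_mu_def B_def[symmetric] Let_def)
qed

lemma alpha_mu_le_norm:
  assumes "inner_product ip"
  obtains K where "K > 0" "\<And>A. \<bar>det A\<bar> = 1 \<Longrightarrow> alpha_mu ip (proj A) \<le> 2 * ln (K * norm A)"
proof -
  obtain K where K: "K > 0"
    "\<And>A s. \<bar>det A\<bar> = 1 \<Longrightarrow> s \<in> singular_values ip A \<Longrightarrow> s \<le> K * norm A \<and> 1 \<le> K * norm A * s"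
    using singular_values_bounds[OF assms] by metis
  have "alpha_mu ip (proj A) \<le> 2 * ln (K * norm A)" if A: "\<bar>det A\<bar> = 1" for A
  proof -
    note sv = singular_values_finite_nonempty[OF assms, of A]
    define M m where "M = Max (singular_values ip A)" and "m = Min (singular_values ip A)"
    have mem: "M \<in> singular_values ip A" "m \<in> singular_values ip A"
      unfolding M_def m_def using Max_in[OF sv] Min_in[OF sv] by simp_all
    have bounds: "M \<le> K * norm A" "1 \<le> K * norm A * M" "1 \<le> K * norm A * m"
      using K(2)[OF A] mem by blast+
    have KA: "K * norm A > 0"
    proof -
      have "A \<noteq> 0" using A by (auto simp: det_2)
      then show ?thesis using K(1) by simp
    qed
    have "K * norm A * M > 0" "K * norm A * m > 0" using bounds by linarith+
    then have pos: "M > 0" "m > 0" using KA zero_less_mult_pos by blast+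
    have "ln M \<le> ln (K * norm A)" using bounds(1) pos(1) KA by simp
    moreover have "0 \<le> ln (K * norm A * m)" using bounds(3) by simp
    then have "0 \<le> ln (K * norm A) + ln m" using KA pos(2) by (simp only: ln_mult_pos)
    ultimately have "ln M - ln m \<le> 2 * ln (K * norm A)" by linarith
    then show ?thesis unfolding alpha_mu_proj[OF assms A] M_def m_def .
  qed
  then show ?thesis using K(1) that by blast
qed

primrec mpow :: "real^2^2 \<Rightarrow> nat \<Rightarrow> real^2^2" where
  "mpow A 0 = mat 1"
| "mpow A (Suc k) = A ** mpow A k"

text \<open>The Lucas sequence of the polynomial \<open>X\<^sup>2 - t X + d\<close>. By the theorem of Cayley and Hamilton it
  expresses the powers of a matrix with trace \<open>t\<close> and determinant \<open>d\<close> by the matrix and the identity.\<close>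

fun lucas :: "real \<Rightarrow> real \<Rightarrow> nat \<Rightarrow> real" where
  "lucas t d 0 = 0"
| "lucas t d (Suc 0) = 1"
| "lucas t d (Suc (Suc k)) = t * lucas t d (Suc k) - d * lucas t d k"

lemma cayley_hamilton_2: "A ** A = trace A *\<^sub>R A - det A *\<^sub>R mat 1" for A :: "real^2^2"
  by (simp add: vec_eq_iff forall_2 matrix_matrix_2 trace_2 det_2 mat_def algebra_simps)

lemma mpow_eq_lucas:
  "mpow A (Suc k) = lucas (trace A) (det A) (Suc k) *\<^sub>R A - (det A * lucas (trace A) (det A) k) *\<^sub>R mat 1"
proof (induction k)
  case (Suc k)
  let ?u = "lucas (trace A) (det A)"
  have "mpow A (Suc (Suc k)) = A ** (?u (Suc k) *\<^sub>R A - (det A * ?u k) *\<^sub>R mat 1)"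
    using Suc by simp
  also have "\<dots> = ?u (Suc k) *\<^sub>R (A ** A) - (det A * ?u k) *\<^sub>R A"
    by (simp add: vec_eq_iff forall_2 matrix_matrix_2 mat_def algebra_simps)
  also have "\<dots> = ?u (Suc (Suc k)) *\<^sub>R A - (det A * ?u (Suc k)) *\<^sub>R mat 1"
    unfolding cayley_hamilton_2 by (simp add: algebra_simps)
  finally show ?case .
qed simp

text \<open>With the roots \<open>a\<close> and \<open>b\<close>, the \<open>k\<close>-th term is the sum of the \<open>k\<close> products \<open>a\<^sup>i b\<^sup>j\<close> with
  \<open>i + j = k - 1\<close>. This holds for a double root as well, so parabolic matrices need no
  separate treatment.\<close>

lemma lucas_bound:
  fixes a b :: complex
  assumes "a + b = of_real t" "a * b = of_real d" "norm a \<le> L" "norm b \<le> L" "1 \<le> L"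
  shows "\<bar>lucas t d k\<bar> \<le> real k * L ^ k"
proof -
  define h where "h = rec_nat (0 :: complex) (\<lambda>k x. a * x + b ^ k)"
  have h: "h 0 = 0" "h (Suc k) = a * h k + b ^ k" for k by (simp_all add: h_def)
  have lucas_h: "of_real (lucas t d k) = h k \<and> of_real (lucas t d (Suc k)) = h (Suc k)" for k
  proof (induction k)
    case (Suc k)
    have "h (Suc (Suc k)) = (a + b) * h (Suc k) - (a * b) * h k"
      by (simp add: h algebra_simps)
    then show ?case using Suc by (simp add: assms(1,2))
  qed (simp add: h)
  have "norm (h k) \<le> real k * L ^ k"
  proof (induction k)
    case (Suc k)
    have "norm (h (Suc k)) \<le> norm a * norm (h k) + norm b ^ k"
      unfolding h using norm_triangle_ineq[of "a * h k" "b ^ k"] by (simp add: norm_mult norm_power)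
    also have "\<dots> \<le> L * (real k * L ^ k) + L ^ k"
      using Suc assms by (intro add_mono mult_mono power_mono) auto
    also have "\<dots> \<le> L * (real k * L ^ k) + L * L ^ k"
      using assms(5) by (simp add: mult_le_cancel_right1)
    finally show ?case by (simp add: algebra_simps)
  qed (simp add: h)
  moreover have "norm (h k) = \<bar>lucas t d k\<bar>" using lucas_h[of k] by (metis norm_of_real)
  ultimately show ?thesis by simp
qed

section \<open>Growth of powers and traces\<close>

text \<open>For determinant \<open>\<plusminus>1\<close> this is the existence of an eigenvalue of modulus greater than \<open>1\<close>: hyperbolic
  isometries for determinant \<open>1\<close> and glide reflections with a nontrivial translation for \<open>-1\<close>.\<close>

definition loxodromic :: "real^2^2 \<Rightarrow> bool" where
  "loxodromic A \<longleftrightarrow> (det A = 1 \<longrightarrow> \<bar>trace A\<bar> > 2) \<and> (det A = -1 \<longrightarrow> trace A \<noteq> 0)"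

lemma det_mpow: "\<bar>det A\<bar> = 1 \<Longrightarrow> \<bar>det (mpow A k)\<bar> = 1"
  by (induction k) (simp_all add: det_mul abs_mult)

lemma norm_mpow_le:
  fixes a b :: complex
  assumes A: "\<bar>det A\<bar> = 1" and ab: "a + b = of_real (trace A)" "a * b = of_real (det A)"
    "norm a \<le> L" "norm b \<le> L" "1 \<le> L"
  shows "norm (mpow A (Suc k)) \<le> real (Suc k) * L ^ Suc k * (norm A + norm (mat 1 :: real^2^2))"
proof -
  let ?u = "lucas (trace A) (det A)"
  let ?B = "real (Suc k) * L ^ Suc k"
  have u: "\<bar>?u (Suc k)\<bar> \<le> ?B" by (rule lucas_bound[OF ab])
  have "\<bar>?u k\<bar> \<le> real k * L ^ k" by (rule lucas_bound[OF ab])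
  also have "\<dots> \<le> ?B" using ab(5) by (intro mult_mono power_increasing) auto
  finally have u': "\<bar>?u k\<bar> \<le> ?B" .
  have "norm (mpow A (Suc k)) \<le> norm (?u (Suc k) *\<^sub>R A) + norm ((det A * ?u k) *\<^sub>R (mat 1 :: real^2^2))"
    unfolding mpow_eq_lucas by (rule norm_triangle_ineq4)
  also have "\<dots> = \<bar>?u (Suc k)\<bar> * norm A + \<bar>?u k\<bar> * norm (mat 1 :: real^2^2)"
    using A by (simp add: abs_mult)
  also have "\<dots> \<le> ?B * norm A + ?B * norm (mat 1 :: real^2^2)"
    using u u' by (intro add_mono mult_right_mono) auto
  finally show ?thesis by (simp only: distrib_left)
qed

lemma eigenvalue_le:
  fixes a :: complex
  assumes "a\<^sup>2 = of_real t * a - of_real d" "\<bar>d\<bar> = 1"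
  shows "norm a \<le> 1 + \<bar>t\<bar>"
proof (rule ccontr)
  assume "\<not> ?thesis"
  then have a: "norm a > 1 + \<bar>t\<bar>" by simp
  have "norm a * norm a = norm (of_real t * a - of_real d)"
    using assms(1) by (metis norm_mult power2_eq_square)
  also have "\<dots> \<le> \<bar>t\<bar> * norm a + 1"
    using norm_triangle_ineq4[of "of_real t * a" "of_real d"] assms(2) by (simp add: norm_mult)
  also have "\<dots> < \<bar>t\<bar> * norm a + norm a" using a by simp
  also have "\<dots> = (1 + \<bar>t\<bar>) * norm a" by (simp add: algebra_simps)
  also have "\<dots> \<le> norm a * norm a" using a by (intro mult_right_mono) auto
  finally show False by simp
qed

text \<open>If the matrix is not loxodromic, then its eigenvalues lie on the unit circle: they are complex
  conjugate or a double root \<open>\<plusminus>1\<close> for determinant \<open>1\<close>, and \<open>1\<close> and \<open>-1\<close> for determinant \<open>-1\<close>.\<close>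

lemma spectral_bound:
  assumes A: "\<bar>det A\<bar> = 1"
  obtains a b :: complex and L where "a + b = of_real (trace A)" "a * b = of_real (det A)"
    "norm a \<le> L" "norm b \<le> L" "1 \<le> L" "L \<le> 1 + \<bar>trace A\<bar>" "\<not> loxodromic A \<Longrightarrow> L = 1"
proof -
  define t d where "t = trace A" and "d = det A"
  note td = t_def[symmetric] d_def[symmetric]
  have d: "d = 1 \<or> d = -1" using A by (auto simp: d_def)
  show ?thesis
  proof (cases "loxodromic A")
    case True
    define r where "r = csqrt (of_real (t\<^sup>2 - 4 * d))"
    have r: "r\<^sup>2 = (of_real t)\<^sup>2 - 4 * of_real d" by (simp add: r_def)
    define a b where "a = (of_real t + r) / 2" and "b = (of_real t - r) / 2"
    have s: "a + b = of_real t" by (simp add: a_def b_def field_simps)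
    have "a * b = ((of_real t)\<^sup>2 - r\<^sup>2) / 4" by (simp add: a_def b_def power2_eq_square algebra_simps)
    then have p: "a * b = of_real d" by (simp add: r)
    have "a\<^sup>2 = (a + b) * a - a * b" "b\<^sup>2 = (a + b) * b - a * b"
      by (simp_all add: power2_eq_square algebra_simps)
    then have "a\<^sup>2 = of_real t * a - of_real d" "b\<^sup>2 = of_real t * b - of_real d"
      unfolding s p .
    then have "norm a \<le> 1 + \<bar>t\<bar>" "norm b \<le> 1 + \<bar>t\<bar>"
      using eigenvalue_le A by (simp_all add: d_def)
    with s p True show ?thesis by (intro that[of a b "1 + \<bar>t\<bar>"]) (simp_all add: td)
  next
    case False
    then have "d = 1 \<and> \<bar>t\<bar> \<le> 2 \<or> d = -1 \<and> t = 0" using d by (auto simp: loxodromic_def td)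
    then show ?thesis
    proof
      assume td1: "d = 1 \<and> \<bar>t\<bar> \<le> 2"
      then have "t\<^sup>2 \<le> 2\<^sup>2" using abs_le_square_iff[of t 2] by simp
      then have q: "(sqrt (4 - t\<^sup>2))\<^sup>2 = 4 - t\<^sup>2" by simp
      define a where "a = Complex (t / 2) (sqrt (4 - t\<^sup>2) / 2)"
      have cmod: "(cmod a)\<^sup>2 = 1" using q by (simp add: a_def cmod_power2 power_divide field_simps)
      have "a + cnj a = of_real t" by (simp add: a_def complex_eq_iff)
      moreover have "a * cnj a = of_real d" using cmod td1 complex_norm_square[of a] by simp
      moreover have "norm a = 1" using cmod by (simp add: power2_eq_1_iff) (smt (verit) norm_ge_zero)
      ultimately show ?thesis by (intro that[of a "cnj a" 1]) (simp_all add: td)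
    next
      assume "d = -1 \<and> t = 0"
      then show ?thesis by (intro that[of 1 "-1" 1]) (simp_all add: td)
    qed
  qed
qed

text \<open>The upper bound for \<open>\<alpha>\<close> of the \<open>k\<close>-th power is \<open>2 k ln L\<close> up to a logarithmic error, so that
  \<open>c \<le> 2 ln L\<close> follows on dividing by \<open>k\<close>. As \<open>c\<close> is positive, \<open>L = 1\<close> is impossible.\<close>

lemma growth_trace:
  assumes ip: "inner_product ip" and A: "\<bar>det A\<bar> = 1" and c: "c > 0"
    and growth: "\<And>k. alpha_mu ip (proj (mpow A k)) \<ge> c * real k - c'"
  shows "loxodromic A" "c \<le> 2 * ln (1 + \<bar>trace A\<bar>)"
proof -
  obtain a b :: complex and L where ab: "a + b = of_real (trace A)" "a * b = of_real (det A)"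
    "norm a \<le> L" "norm b \<le> L" "1 \<le> L" and L: "L \<le> 1 + \<bar>trace A\<bar>" "\<not> loxodromic A \<Longrightarrow> L = 1"
    using spectral_bound[OF A] by metis
  obtain K where K: "K > 0" "\<And>A. \<bar>det A\<bar> = 1 \<Longrightarrow> alpha_mu ip (proj A) \<le> 2 * ln (K * norm A)"
    using alpha_mu_le_norm[OF ip] by metis
  define N where "N = K * (norm A + norm (mat 1 :: real^2^2))"
  have "A \<noteq> 0" using A by (auto simp: det_2)
  then have N: "N > 0" using K(1) by (simp add: N_def add_pos_nonneg)
  have bound: "c * real (Suc k) - c' \<le> 2 * ln N + 2 * ln (real (Suc k)) + 2 * (real (Suc k) * ln L)" for k
  proof -
    let ?M = "mpow A (Suc k)"
    have dM: "\<bar>det ?M\<bar> = 1" by (rule det_mpow[OF A])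
    then have "?M \<noteq> 0" by (auto simp: det_2)
    then have pos: "K * norm ?M > 0" using K(1) by simp
    have "K * norm ?M \<le> K * (real (Suc k) * L ^ Suc k * (norm A + norm (mat 1 :: real^2^2)))"
      using norm_mpow_le[OF A ab] K(1) by (intro mult_left_mono) auto
    also have "\<dots> = N * (real (Suc k) * L ^ Suc k)" by (simp add: N_def mult_ac)
    finally have "ln (K * norm ?M) \<le> ln (N * (real (Suc k) * L ^ Suc k))"
      using pos by (intro ln_mono) auto
    also have "\<dots> = ln N + (ln (real (Suc k)) + real (Suc k) * ln L)"
      using N ab(5) by (simp only: ln_mult_pos ln_realpow zero_less_power mult_pos_pos of_nat_0_less_iff zero_less_Suc less_le_trans[OF zero_less_one])
    finally show ?thesis using growth[of "Suc k"] K(2)[OF dM] by linarith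
  qed
  have "c - 2 * ln L \<le> 0"
  proof (rule LIMSEQ_le_const)
    have "(\<lambda>k. (2 * ln N + c') / real k + 2 * (ln (real k) / real k)) \<longlonglongrightarrow> 0 + 2 * 0"
      using lim_ln_over_n by (intro tendsto_add tendsto_mult lim_const_over_n tendsto_const) (simp_all add: lim_ln_over_n)
    then show "(\<lambda>k. (2 * ln N + c') / real k + 2 * (ln (real k) / real k)) \<longlonglongrightarrow> 0" by simp
    have "c - 2 * ln L \<le> (2 * ln N + c') / real k + 2 * (ln (real k) / real k)" if k: "k \<ge> 1" for k
    proof -
      obtain j where j: "k = Suc j" using k by (cases k) auto
      have "(c - 2 * ln L) * real k \<le> 2 * ln N + c' + 2 * ln (real k)"
        using bound[of j] unfolding j by (simp add: algebra_simps)
      then have "c - 2 * ln L \<le> (2 * ln N + c' + 2 * ln (real k)) / real k"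
        using k by (simp add: pos_le_divide_eq)
      then show ?thesis by (simp add: add_divide_distrib)
    qed
    then show "\<exists>n. \<forall>k\<ge>n. c - 2 * ln L \<le> (2 * ln N + c') / real k + 2 * (ln (real k) / real k)" by blast
  qed
  then have cL: "c \<le> 2 * ln L" by simp
  show "loxodromic A" using cL c L(2) by force
  have "ln L \<le> ln (1 + \<bar>trace A\<bar>)" using L(1) ab(5) by (intro ln_mono) auto
  with cL show "c \<le> 2 * ln (1 + \<bar>trace A\<bar>)" by linarith
qed

lemma proj_self: "A \<in> proj A"
  by (auto simp: proj_def intro: exI[of _ "1::real"])

lemma proj_uminus: "proj (- A) = proj A"
  using proj_scaleR[of "-1" A] by simp

lemma carrier_PGL2E:
  assumes "g \<in> carrier PGL2"
  obtains A where "\<bar>det A\<bar> = 1" "g = proj A"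
proof -
  obtain A where A: "invertible A" "g = scalars #>\<^bsub>GL2\<^esub> A"
    using assms by (auto simp: PGL2_def FactGroup_def RCOSETS_def GL2_def)
  have "(c *\<^sub>R mat 1) ** A = c *\<^sub>R A" for c by (simp add: scalar_matrix_assoc[symmetric])
  then have "g = proj A" using A(2) by (auto simp: r_coset_def scalars_def GL2_def proj_def)
  have d: "det A \<noteq> 0" using A(1) invertible_det_nz by blast
  define c where "c = 1 / sqrt \<bar>det A\<bar>"
  have "\<bar>det (c *\<^sub>R A)\<bar> = 1" using d by (simp add: det_scaleR_2 c_def abs_mult power_divide)
  moreover have "g = proj (c *\<^sub>R A)" using \<open>g = proj A\<close> proj_scaleR[of c A] d by (simp add: c_def)
  ultimately show ?thesis using that by blast
qed

lemma proj_mult: "proj A \<otimes>\<^bsub>PGL2\<^esub> proj B = proj (A ** B)"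
proof -
  have mult: "(c *\<^sub>R A) ** (d *\<^sub>R B) = (c * d) *\<^sub>R (A ** B)" for c d
    by (simp add: vec_eq_iff matrix_matrix_2 algebra_simps)
  have "proj A \<otimes>\<^bsub>PGL2\<^esub> proj B = {M ** N | M N. M \<in> proj A \<and> N \<in> proj B}"
    by (auto simp: PGL2_def FactGroup_def set_mult_def GL2_def)
  also have "\<dots> = proj (A ** B)"
  proof (intro equalityI subsetI)
    fix M assume "M \<in> {M ** N | M N. M \<in> proj A \<and> N \<in> proj B}"
    then obtain c d where "c \<noteq> 0" "d \<noteq> 0" "M = (c *\<^sub>R A) ** (d *\<^sub>R B)" by (auto simp: proj_def)
    then show "M \<in> proj (A ** B)" by (auto simp: mult proj_def)
  next
    fix M assume "M \<in> proj (A ** B)"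
    then obtain c where c: "c \<noteq> 0" "M = c *\<^sub>R (A ** B)" by (auto simp: proj_def)
    then have "M = (c *\<^sub>R A) ** (1 *\<^sub>R B)" unfolding mult by simp
    moreover have "c *\<^sub>R A \<in> proj A" "1 *\<^sub>R B \<in> proj B"
      using c by (auto simp: proj_def intro: exI[of _ "1::real"])
    ultimately show "M \<in> {M ** N | M N. M \<in> proj A \<and> N \<in> proj B}" by blast
  qed
  finally show ?thesis .
qed

lemma proj_one: "\<one>\<^bsub>PGL2\<^esub> = proj (mat 1)"
  by (auto simp: PGL2_def FactGroup_def proj_def scalars_def)

lemma proj_eqD:
  assumes "proj A = proj B" "\<bar>det A\<bar> = 1" "\<bar>det B\<bar> = 1"
  shows "A = B \<or> A = - B"
  using proj_normalized[OF assms(3) _ assms(2)] proj_self[of A] assms(1) by simp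

section \<open>Word metrics and axes\<close>

context group
begin

lemma cancel_inv:
  assumes "h \<in> carrier G" "x \<in> carrier G"
  shows "inv h \<otimes> (h \<otimes> x) = x" "h \<otimes> (inv h \<otimes> x) = x"
  using assms by (simp_all add: m_assoc[symmetric])

lemma word_length_one: "word_length G S \<one> = 0"
  unfolding word_length_def by (rule Least_equality) (auto intro!: exI[of _ "[]"])

lemma word_dist_self: "x \<in> carrier G \<Longrightarrow> word_dist G S x x = 0"
  by (simp add: word_dist_def word_length_one)

lemma word_dist_left_invariant:
  assumes "h \<in> carrier G" "x \<in> carrier G" "y \<in> carrier G"
  shows "word_dist G S (h \<otimes> x) (h \<otimes> y) = word_dist G S x y"
  using assms by (simp add: word_dist_def inv_mult_group m_assoc cancel_inv)

lemma foldr_mult_closed: "set xs \<subseteq> carrier G \<Longrightarrow> foldr (\<otimes>) xs \<one> \<in> carrier G"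
  by (induction xs) auto

lemma foldr_mult_append:
  "set xs \<subseteq> carrier G \<Longrightarrow> set ys \<subseteq> carrier G \<Longrightarrow>
    foldr (\<otimes>) (xs @ ys) \<one> = foldr (\<otimes>) xs \<one> \<otimes> foldr (\<otimes>) ys \<one>"
  by (induction xs) (simp_all add: m_assoc foldr_mult_closed del: foldr_append)

lemma generate_imp_word:
  assumes S: "S \<subseteq> carrier G" and "x \<in> generate G S"
  shows "\<exists>xs. set xs \<subseteq> S \<union> m_inv G ` S \<and> foldr (\<otimes>) xs \<one> = x"
  using assms(2)
proof induction
  case one
  show ?case by (intro exI[of _ "[]"]) simp
next
  case (incl h)
  then show ?case using S by (intro exI[of _ "[h]"]) auto
next
  case (inv h)
  then show ?case using S by (intro exI[of _ "[inv h]"]) auto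
next
  case (eng h1 h2)
  then obtain xs ys where xs: "set xs \<subseteq> S \<union> m_inv G ` S" "foldr (\<otimes>) xs \<one> = h1" and
    ys: "set ys \<subseteq> S \<union> m_inv G ` S" "foldr (\<otimes>) ys \<one> = h2" by blast
  have "S \<union> m_inv G ` S \<subseteq> carrier G" using S by auto
  then have "set xs \<subseteq> carrier G" "set ys \<subseteq> carrier G" using xs(1) ys(1) by blast+
  then have "foldr (\<otimes>) (xs @ ys) \<one> = h1 \<otimes> h2" unfolding xs(2)[symmetric] ys(2)[symmetric]
    by (rule foldr_mult_append)
  then show ?case using xs(1) ys(1) by (intro exI[of _ "xs @ ys"]) auto
qed

lemma finite_word_ball:
  assumes "finite S" "S \<subseteq> carrier G" "generate G S = carrier G"
  shows "finite {x \<in> carrier G. word_length G S x \<le> N}"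
proof (rule finite_subset)
  let ?T = "S \<union> m_inv G ` S"
  show "finite ((\<lambda>xs. foldr (\<otimes>) xs \<one>) ` {xs. set xs \<subseteq> ?T \<and> length xs \<le> N})"
    using assms(1) by (intro finite_imageI finite_lists_length_le) auto
  show "{x \<in> carrier G. word_length G S x \<le> N} \<subseteq>
      (\<lambda>xs. foldr (\<otimes>) xs \<one>) ` {xs. set xs \<subseteq> ?T \<and> length xs \<le> N}"
  proof
    fix x assume x: "x \<in> {x \<in> carrier G. word_length G S x \<le> N}"
    let ?P = "\<lambda>n. \<exists>xs. length xs = n \<and> set xs \<subseteq> ?T \<and> foldr (\<otimes>) xs \<one> = x"
    have "\<exists>n. ?P n" using generate_imp_word[OF assms(2), of x] assms(3) x by auto
    then have "?P (word_length G S x)" unfolding word_length_def by (rule LeastI_ex)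
    then show "x \<in> (\<lambda>xs. foldr (\<otimes>) xs \<one>) ` {xs. set xs \<subseteq> ?T \<and> length xs \<le> N}" using x by auto
  qed
qed

lemma primitive_conjugate:
  assumes "primitive G g" "h \<in> carrier G"
  shows "primitive G (inv h \<otimes> g \<otimes> h)"
proof -
  obtain T where T: "card T = 2" "T \<subseteq> carrier G" "generate G T = carrier G" "g \<in> T"
    using assms(1) by (auto simp: primitive_def)
  let ?c = "\<lambda>x. inv h \<otimes> x \<otimes> h"
  have hom: "?c \<in> hom G G"
  proof (rule homI)
    fix x y assume xy: "x \<in> carrier G" "y \<in> carrier G"
    then show "?c (x \<otimes> y) = ?c x \<otimes> ?c y" using assms(2) by (simp add: m_assoc cancel_inv)
  qed (use assms(2) in auto)
  then interpret c: group_hom G G ?c by unfold_locales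
  have inj: "inj_on ?c (carrier G)" using assms(2) by (auto intro!: inj_onI)
  have "?c ` carrier G = carrier G"
  proof (intro equalityI subsetI)
    fix x assume x: "x \<in> carrier G"
    have "x = ?c (h \<otimes> x \<otimes> inv h)" using x assms(2) by (simp add: m_assoc cancel_inv)
    moreover have "h \<otimes> x \<otimes> inv h \<in> carrier G" using x assms(2) by simp
    ultimately show "x \<in> ?c ` carrier G" by blast
  qed (use assms(2) in auto)
  moreover have "generate G (?c ` T) = ?c ` generate G T" by (rule c.generate_img[OF T(2)])
  moreover have "card (?c ` T) = 2" using T(1,2) inj by (metis card_image inj_on_subset)
  moreover have "?c ` T \<subseteq> carrier G" using T(2) assms(2) by auto
  ultimately show ?thesis unfolding primitive_def using T(3,4) by (intro exI[of _ "?c ` T"]) auto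
qed

text \<open>Via the axis, \<open>g\<close> acts on the integers by an isometry, which is a translation or a reflection. In
  the latter case, \<open>g\<close> would be an involution.\<close>

lemma axis_translation:
  assumes axis: "is_axis G S g \<xi>" and no_involution: "g \<otimes> g = \<one> \<Longrightarrow> g = \<one>"
  obtains n where "n \<noteq> 0" "\<And>i. g \<otimes> \<xi> i = \<xi> (i + n)"
proof -
  have g: "g \<in> carrier G" "g \<noteq> \<one>" and \<xi>: "\<And>i. \<xi> i \<in> carrier G" and
    dist: "\<And>i j. int (word_dist G S (\<xi> i) (\<xi> j)) = \<bar>i - j\<bar>" and
    image: "(\<lambda>x. g \<otimes> x) ` range \<xi> = range \<xi>"
    using axis by (auto simp: is_axis_def)
  have inj: "i = j" if "\<xi> i = \<xi> j" for i j
    using dist[of i j] word_dist_self[OF \<xi>, of S j] that by simp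
  have "\<forall>i. \<exists>j. g \<otimes> \<xi> i = \<xi> j" using image by blast
  then obtain \<tau> where \<tau>: "\<And>i. g \<otimes> \<xi> i = \<xi> (\<tau> i)" by metis
  have iso: "\<bar>\<tau> i - \<tau> j\<bar> = \<bar>i - j\<bar>" for i j
    using dist[of "\<tau> i" "\<tau> j"] dist[of i j] word_dist_left_invariant[OF g(1) \<xi> \<xi>, of S i j]
    by (simp add: \<tau>)
  define n where "n = \<tau> 0"
  have "n \<noteq> 0"
  proof
    assume "n = 0"
    then have "g \<otimes> \<xi> 0 = \<xi> 0" using \<tau>[of 0] by (simp add: n_def)
    then show False using g \<xi>[of 0] by simp
  qed
  have "\<tau> i = i + n" for i
  proof -
    have "\<tau> 1 = n + 1 \<or> \<tau> 1 = n - 1" using iso[of 1 0] unfolding n_def by linarith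
    then show ?thesis
    proof
      assume "\<tau> 1 = n + 1"
      then show ?thesis using iso[of i 0] iso[of i 1] unfolding n_def by linarith
    next
      assume 1: "\<tau> 1 = n - 1"
      have "\<tau> n = 0" using iso[of n 0] iso[of n 1] 1 unfolding n_def by linarith
      then have "g \<otimes> (g \<otimes> \<xi> 0) = \<xi> 0" using \<tau>[of 0] \<tau>[of n] by (simp add: n_def)
      then have "(g \<otimes> g) \<otimes> \<xi> 0 = \<xi> 0" using g \<xi> by (simp add: m_assoc)
      then have "g \<otimes> g = \<one>" using g(1) \<xi>[of 0] by simp
      then show ?thesis using no_involution g by simp
    qed
  qed
  then show ?thesis using \<open>n \<noteq> 0\<close> \<tau> that by simp
qed

text \<open>Conjugating with a point \<open>h\<close> of the axis moves that point to the identity. The conjugate of \<open>g\<close> and its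
  powers then lie on the ray that follows the axis in the direction of translation, spaced by the
  translation length \<open>m\<close>. Following the direction of translation avoids passing to \<open>g\<^sup>-\<^sup>1\<close>.\<close>

lemma axis_rooted_ray:
  assumes prim: "primitive G g" and axis: "is_axis G S g \<xi>" and no_involution: "g \<otimes> g = \<one> \<Longrightarrow> g = \<one>"
  obtains h m \<eta> where "h \<in> carrier G" "m \<ge> 1" "primitive_ray G S \<eta>" "\<eta> 0 = \<one>"
    "word_length G S (inv h \<otimes> g \<otimes> h) = m" "\<And>k. \<eta> (m * k) = (inv h \<otimes> g \<otimes> h) [^] (k :: nat)"
proof -
  obtain n where n: "n \<noteq> 0" "\<And>i. g \<otimes> \<xi> i = \<xi> (i + n)"
    using axis_translation[OF axis no_involution] by blast
  have g: "g \<in> carrier G" "g \<noteq> \<one>" and \<xi>: "\<And>i. \<xi> i \<in> carrier G" and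
    dist: "\<And>i j. int (word_dist G S (\<xi> i) (\<xi> j)) = \<bar>i - j\<bar>" and
    image: "(\<lambda>x. g \<otimes> x) ` range \<xi> = range \<xi>"
    using axis by (auto simp: is_axis_def)
  define h where "h = \<xi> 0"
  have h: "h \<in> carrier G" using \<xi> by (simp add: h_def)
  define c where "c = inv h \<otimes> g \<otimes> h"
  have c: "c \<in> carrier G" using h g by (simp add: c_def)
  define m where "m = nat \<bar>n\<bar>"
  define \<xi>' where "\<xi>' i = inv h \<otimes> \<xi> i" for i
  define \<eta> where "\<eta> j = \<xi>' (sgn n * int j)" for j :: nat
  have \<xi>': "\<xi>' i \<in> carrier G" for i using h \<xi> by (simp add: \<xi>'_def)
  have dist': "int (word_dist G S (\<xi>' i) (\<xi>' j)) = \<bar>i - j\<bar>" for i j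
    using dist[of i j] word_dist_left_invariant[of "inv h" "\<xi> i" "\<xi> j" S] h \<xi> by (simp add: \<xi>'_def)
  have shift: "c \<otimes> \<xi>' i = \<xi>' (i + n)" for i
  proof -
    have "c \<otimes> \<xi>' i = inv h \<otimes> (g \<otimes> \<xi> i)"
      unfolding c_def \<xi>'_def using g h \<xi> by (simp add: m_assoc cancel_inv)
    then show ?thesis by (simp add: \<xi>'_def n(2))
  qed
  have "is_axis G S c \<xi>'"
  proof -
    have "c \<noteq> \<one>"
    proof
      assume "c = \<one>"
      then have "\<xi>' 0 = \<xi>' n" using shift[of 0] \<xi>' by simp
      then show False using dist'[of 0 n] word_dist_self[OF \<xi>', of S n] n(1) by simp
    qed
    moreover have "(\<lambda>x. c \<otimes> x) ` range \<xi>' = range \<xi>'"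
    proof -
      have "(\<lambda>x. c \<otimes> x) ` range \<xi>' = \<xi>' ` range (\<lambda>i. i + n)"
        by (simp only: shift image_image)
      moreover have "surj (\<lambda>i::int. i + n)" by (rule surjI[of _ "\<lambda>i. i - n"]) simp
      ultimately show ?thesis by simp
    qed
    ultimately show ?thesis unfolding is_axis_def using c \<xi>' dist' by auto
  qed
  moreover have "primitive G c" unfolding c_def by (rule primitive_conjugate[OF prim h])
  moreover have "int (word_dist G S (\<eta> i) (\<eta> j)) = \<bar>int i - int j\<bar>" for i j
  proof -
    have "\<bar>sgn n * int i - sgn n * int j\<bar> = \<bar>int i - int j\<bar>"
      using n(1) by (cases "n > 0") (simp_all add: sgn_if)
    then show ?thesis by (simp add: \<eta>_def dist')
  qed
  moreover have "range \<eta> \<subseteq> range \<xi>'" by (auto simp: \<eta>_def)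
  ultimately have ray: "primitive_ray G S \<eta>" unfolding primitive_ray_def by blast
  have \<eta>0: "\<eta> 0 = \<one>" using h by (simp add: \<eta>_def \<xi>'_def h_def)
  have m: "m \<ge> 1" "sgn n * int m = n" using n(1) by (simp_all add: m_def sgn_if)
  have "c \<otimes> \<eta> j = \<eta> (j + m)" for j
    using m(2) by (simp add: \<eta>_def shift distrib_left)
  then have step: "\<eta> (m + j) = c \<otimes> \<eta> j" for j by (simp add: add.commute)
  have pow: "\<eta> (m * k) = c [^] k" for k
  proof (induction k)
    case (Suc k)
    then show ?case using step[of "m * k"] nat_pow_Suc2[OF c, of k] by simp
  qed (simp add: \<eta>0)
  have "\<eta> m \<in> carrier G" "c = \<eta> m" using pow[of 1] c by simp_all
  moreover have "int (word_dist G S (\<eta> 0) (\<eta> m)) = int m"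
    using ray unfolding primitive_ray_def by auto
  ultimately have "word_length G S c = m" using c by (simp add: word_dist_def \<eta>0)
  then show ?thesis using that[OF h m(1) ray \<eta>0] pow unfolding c_def by blast
qed

end

section \<open>Bases of the free group\<close>

lemma carrier_F2: "x \<in> carrier F2 \<longleftrightarrow> reduced x"
  by (simp add: F2_def)

lemma one_F2: "\<one>\<^bsub>F2\<^esub> = []"
  by (simp add: F2_def)

lemma mult_F2: "x \<otimes>\<^bsub>F2\<^esub> y = foldr push x y"
  by (simp add: F2_def)

lemma reduced_inverse_word:
  assumes "reduced u"
  shows "reduced (map letter_inv (rev u))"
  unfolding reduced_def
proof (intro allI impI)
  fix i assume i: "Suc i < length (map letter_inv (rev u))"
  define j where "j = length u - Suc (Suc i)"
  have j: "Suc j < length u" "length u - Suc i = Suc j" using i by (simp_all add: j_def)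
  have "u ! Suc j \<noteq> letter_inv (u ! j)" using assms j(1) by (simp add: reduced_def)
  then have "letter_inv (u ! j) \<noteq> u ! Suc j" by metis
  then show "map letter_inv (rev u) ! Suc i \<noteq> letter_inv (map letter_inv (rev u) ! i)"
    using i j by (simp add: rev_nth j_def)
qed

text \<open>A reduced word that equals its formal inverse has a middle letter equal to its own inverse, or two
  middle letters that cancel.\<close>

lemma F2_no_involution:
  assumes x: "x \<in> carrier F2" and xx: "x \<otimes>\<^bsub>F2\<^esub> x = \<one>\<^bsub>F2\<^esub>"
  shows "x = \<one>\<^bsub>F2\<^esub>"
proof (rule ccontr)
  assume "x \<noteq> \<one>\<^bsub>F2\<^esub>"
  interpret group F2 by (rule group_F2)
  let ?y = "map letter_inv (rev x)"
  have y: "?y \<in> carrier F2" using x reduced_inverse_word by (simp add: carrier_F2)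
  have "?y \<otimes>\<^bsub>F2\<^esub> x = \<one>\<^bsub>F2\<^esub>"
    using foldr_push_left_inverse[of "[]" x] foldr_push_Nil[of x] x
    by (simp add: mult_F2 one_F2 carrier_F2)
  then have "?y \<otimes>\<^bsub>F2\<^esub> x = x \<otimes>\<^bsub>F2\<^esub> x" using xx by simp
  then have eq: "?y = x" using x y by (simp only: r_cancel)
  have nth: "x ! i = letter_inv (x ! (length x - Suc i))" if "i < length x" for i
    using arg_cong[OF eq, of "\<lambda>w. w ! i"] that by (simp add: rev_nth)
  have len: "length x > 0" using \<open>x \<noteq> \<one>\<^bsub>F2\<^esub>\<close> by (simp add: one_F2)
  show False
  proof (cases "even (length x)")
    case True
    then obtain m where "length x = 2 * m" by blast
    then obtain j where j: "length x = 2 * Suc j" using len by (cases m) auto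
    have "x ! Suc j = letter_inv (x ! j)" using nth[of "Suc j"] j by simp
    moreover have "x ! Suc j \<noteq> letter_inv (x ! j)" using x j by (simp add: carrier_F2 reduced_def)
    ultimately show False by simp
  next
    case False
    then obtain m where "length x = 2 * m + 1" by (elim oddE)
    then show False using nth[of m] by simp
  qed
qed

definition basis_pair :: "letter list \<Rightarrow> letter list \<Rightarrow> bool" where
  "basis_pair g h \<longleftrightarrow> g \<in> carrier F2 \<and> h \<in> carrier F2 \<and> generate F2 {g, h} = carrier F2"

lemma basis_pair_letters: "basis_pair [(Gen_a, False)] [(Gen_b, False)]"
proof -
  interpret group F2 by (rule group_F2)
  let ?a = "[(Gen_a, False)]" and ?b = "[(Gen_b, False)]"
  have ab: "?a \<in> carrier F2" "?b \<in> carrier F2" by (simp_all add: carrier_F2)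
  have inv: "inv\<^bsub>F2\<^esub> [(z, False)] = [(z, True)]" for z
  proof (rule inv_equality)
    show "[(z, True)] \<otimes>\<^bsub>F2\<^esub> [(z, False)] = \<one>\<^bsub>F2\<^esub>" by (simp add: mult_F2 one_F2 letter_inv_def)
  qed (simp_all add: carrier_F2)
  have letter: "[l] \<in> generate F2 {?a, ?b}" for l
  proof -
    obtain z s where l: "l = (z, s)" by fastforce
    have "[(z, False)] \<in> {?a, ?b}" by (cases z) auto
    then show ?thesis unfolding l
      using generate.incl[of "[(z, False)]" "{?a, ?b}" F2] generate.inv[of "[(z, False)]" "{?a, ?b}" F2]
      by (cases s) (simp_all add: inv)
  qed
  have "w \<in> generate F2 {?a, ?b}" if "reduced w" for w
    using that
  proof (induction w)
    case Nil
    show ?case using generate.one[of F2] by (simp add: one_F2)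
  next
    case (Cons l w)
    then have "w \<in> generate F2 {?a, ?b}" using reduced_ConsD by blast
    then have "[l] \<otimes>\<^bsub>F2\<^esub> w \<in> generate F2 {?a, ?b}" by (rule generate.eng[OF letter])
    moreover have "[l] \<otimes>\<^bsub>F2\<^esub> w = l # w" using Cons(2) by (cases w) (simp_all add: mult_F2)
    ultimately show ?case by simp
  qed
  then show ?thesis unfolding basis_pair_def using ab generate_incl[of "{?a, ?b}"]
    by (auto simp: carrier_F2)
qed

text \<open>The definition of a primitive element asks for two distinct generators. If they were equal, the
  group would be cyclic, but the two letters do not commute.\<close>

lemma basis_pair_distinct:
  assumes "basis_pair g h"
  shows "g \<noteq> h"
proof
  interpret group F2 by (rule group_F2)
  assume "g = h"
  then have g: "g \<in> carrier F2" "generate F2 {g} = carrier F2"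
    using assms by (auto simp: basis_pair_def)
  let ?a = "[(Gen_a, False)]" and ?b = "[(Gen_b, False)]"
  have "?a \<in> generate F2 {g}" "?b \<in> generate F2 {g}" using g(2) by (simp_all add: carrier_F2)
  then obtain i j :: int where "?a = g [^]\<^bsub>F2\<^esub> i" "?b = g [^]\<^bsub>F2\<^esub> j"
    by (auto simp: generate_pow[OF g(1)])
  then have "?a \<otimes>\<^bsub>F2\<^esub> ?b = ?b \<otimes>\<^bsub>F2\<^esub> ?a"
    using g(1) by (simp add: int_pow_mult[symmetric] add.commute)
  then show False by (simp add: mult_F2 letter_inv_def)
qed

lemma basis_pair_primitive:
  assumes "basis_pair g h"
  shows "primitive F2 g" "primitive F2 h"
proof -
  have "card {g, h} = 2" using basis_pair_distinct[OF assms] by simp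
  then show "primitive F2 g" "primitive F2 h"
    using assms unfolding primitive_def basis_pair_def by (intro exI[of _ "{g, h}"]; simp)+
qed

lemma basis_pair_change:
  assumes "basis_pair g h" "g' \<in> carrier F2" "h' \<in> carrier F2"
    "g \<in> generate F2 {g', h'}" "h \<in> generate F2 {g', h'}"
  shows "basis_pair g' h'"
proof -
  interpret group F2 by (rule group_F2)
  have sub: "subgroup (generate F2 {g', h'}) F2" using assms by (intro generate_is_subgroup) auto
  have "generate F2 {g, h} \<subseteq> generate F2 {g', h'}"
    using assms by (intro generate_subgroup_incl[OF _ sub]) auto
  then show ?thesis using assms generate_incl[of "{g', h'}"] by (auto simp: basis_pair_def)
qed

lemma basis_pair_inverse:
  assumes "basis_pair g h"
  shows "basis_pair (inv\<^bsub>F2\<^esub> g) h"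
proof -
  interpret group F2 by (rule group_F2)
  have gh: "g \<in> carrier F2" "h \<in> carrier F2" using assms by (auto simp: basis_pair_def)
  show ?thesis
  proof (rule basis_pair_change[OF assms])
    show "g \<in> generate F2 {inv\<^bsub>F2\<^esub> g, h}"
      using generate.inv[of "inv\<^bsub>F2\<^esub> g" "{inv\<^bsub>F2\<^esub> g, h}" F2] gh by simp
  qed (use gh in \<open>auto intro: generate.incl\<close>)
qed

lemma basis_pair_mult:
  assumes "basis_pair g h"
  shows "basis_pair g (g \<otimes>\<^bsub>F2\<^esub> h)"
proof -
  interpret group F2 by (rule group_F2)
  have gh: "g \<in> carrier F2" "h \<in> carrier F2" using assms by (auto simp: basis_pair_def)
  let ?K = "{g, g \<otimes>\<^bsub>F2\<^esub> h}"
  show ?thesis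
  proof (rule basis_pair_change[OF assms])
    have "inv\<^bsub>F2\<^esub> g \<otimes>\<^bsub>F2\<^esub> (g \<otimes>\<^bsub>F2\<^esub> h) \<in> generate F2 ?K"
      by (intro generate.eng generate.inv generate.incl) auto
    then show "h \<in> generate F2 ?K" using gh by (simp add: m_assoc[symmetric])
  qed (use gh in \<open>auto intro: generate.incl\<close>)
qed

lemma basis_pair_rotate:
  assumes "basis_pair g h"
  shows "basis_pair h (inv\<^bsub>F2\<^esub> h \<otimes>\<^bsub>F2\<^esub> inv\<^bsub>F2\<^esub> g)"
proof -
  interpret group F2 by (rule group_F2)
  have gh: "g \<in> carrier F2" "h \<in> carrier F2" using assms by (auto simp: basis_pair_def)
  let ?k = "inv\<^bsub>F2\<^esub> h \<otimes>\<^bsub>F2\<^esub> inv\<^bsub>F2\<^esub> g"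
  show ?thesis
  proof (rule basis_pair_change[OF assms])
    have "inv\<^bsub>F2\<^esub> ?k \<otimes>\<^bsub>F2\<^esub> inv\<^bsub>F2\<^esub> h \<in> generate F2 {h, ?k}"
      by (intro generate.eng generate.inv) auto
    then show "g \<in> generate F2 {h, ?k}" using gh by (simp add: inv_mult_group m_assoc)
  qed (use gh in \<open>auto intro: generate.incl\<close>)
qed

section \<open>Trace identities\<close>

lemma trace_uminus: "trace (- A) = - trace (A :: real^2^2)"
  by (simp add: trace_2)

lemma det_uminus_2: "det (- A) = det (A :: real^2^2)"
  by (simp add: det_2)

lemma left_inverse_eq_adjugate:
  fixes A B :: "real^2^2"
  assumes "B ** A = mat 1"
  shows "det A *\<^sub>R B = trace A *\<^sub>R mat 1 - A"
proof -
  have "A = B ** (A ** A)" using assms by (simp add: matrix_mul_assoc)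
  also have "\<dots> = trace A *\<^sub>R (B ** A) - det A *\<^sub>R B"
    unfolding cayley_hamilton_2 by (simp add: vec_eq_iff forall_2 matrix_matrix_2 mat_def algebra_simps)
  finally show ?thesis using assms by (simp add: algebra_simps)
qed

text \<open>The identity behind trace reduction: it follows from \<open>A + det A A\<^sup>-\<^sup>1 = tr A\<close>.\<close>

lemma trace_mult_inverse:
  fixes A B A' :: "real^2^2"
  assumes "A' ** A = mat 1"
  shows "trace (A ** B) + det A * trace (A' ** B) = trace A * trace B"
proof -
  have "det A * trace (A' ** B) = trace ((det A *\<^sub>R A') ** B)"
    by (simp add: trace_2 matrix_matrix_2 algebra_simps)
  also have "\<dots> = trace A * trace B - trace (A ** B)"
    unfolding left_inverse_eq_adjugate[OF assms] by (simp add: trace_2 matrix_matrix_2 mat_def algebra_simps)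
  finally show ?thesis by simp
qed

lemma left_inverse_det_trace:
  fixes A B :: "real^2^2"
  assumes "B ** A = mat 1" "\<bar>det A\<bar> = 1"
  shows "det B = det A" "\<bar>trace B\<bar> = \<bar>trace A\<bar>"
proof -
  have "det B * det A = 1" using arg_cong[OF assms(1), of det] by (simp add: det_mul)
  then show "det B = det A" using assms(2) by (auto simp: abs_if split: if_splits)
  have "det A * trace B = trace A"
  proof -
    have "trace (mat 1 :: real^2^2) = 2" by (simp add: trace_2 mat_def)
    then show ?thesis using trace_mult_inverse[OF assms(1), of "mat 1"] by simp
  qed
  then show "\<bar>trace B\<bar> = \<bar>trace A\<bar>" using assms(2) by (metis abs_mult mult_1)
qed

definition abs_trace :: "(real^2^2) set \<Rightarrow> real" where
  "abs_trace g = \<bar>trace (SOME A. A \<in> g \<and> \<bar>det A\<bar> = 1)\<bar>"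

lemma abs_trace_proj:
  assumes "\<bar>det A\<bar> = 1"
  shows "abs_trace (proj A) = \<bar>trace A\<bar>"
proof -
  define B where "B = (SOME B. B \<in> proj A \<and> \<bar>det B\<bar> = 1)"
  have "B \<in> proj A \<and> \<bar>det B\<bar> = 1"
    unfolding B_def using assms proj_self by (metis (mono_tags, lifting) someI_ex)
  then have "B = A \<or> B = - A" using proj_normalized assms by blast
  then show ?thesis by (auto simp: abs_trace_def B_def[symmetric] trace_uminus)
qed

lemma positive_trace_representative:
  assumes "\<bar>det A\<bar> = 1" "loxodromic A"
  obtains B where "proj B = proj A" "det B = det A" "trace B > 0" "det B = 1 \<Longrightarrow> trace B > 2"
proof -
  have "trace A \<noteq> 0" using assms by (auto simp: loxodromic_def abs_if split: if_splits)
  define B where "B = (if trace A > 0 then A else - A)"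
  have "trace B = \<bar>trace A\<bar>" "det B = det A" "proj B = proj A"
    by (simp_all add: B_def trace_uminus det_uminus_2 proj_uminus)
  then show ?thesis using \<open>trace A \<noteq> 0\<close> assms(2) by (intro that[of B]) (auto simp: loxodromic_def)
qed

section \<open>Bases of minimal trace\<close>

locale pgl_representation =
  fixes \<rho> :: "letter list \<Rightarrow> (real^2^2) set"
  assumes \<rho>: "\<rho> \<in> hom F2 PGL2"
begin

sublocale F2: group F2 by (rule group_F2)

lemma representative:
  assumes "g \<in> carrier F2"
  obtains A where "\<bar>det A\<bar> = 1" "\<rho> g = proj A"
  using carrier_PGL2E[OF hom_in_carrier[OF \<rho> assms]] by metis

lemma \<rho>_mult:
  assumes "g \<in> carrier F2" "h \<in> carrier F2" "\<rho> g = proj A" "\<rho> h = proj B"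
  shows "\<rho> (g \<otimes>\<^bsub>F2\<^esub> h) = proj (A ** B)"
  using hom_mult[OF \<rho> assms(1,2)] assms(3,4) by (simp add: proj_mult)

lemma \<rho>_one: "\<rho> \<one>\<^bsub>F2\<^esub> = proj (mat 1)"
  using hom_one[OF \<rho> group_F2 group_PGL2] by (simp add: proj_one)

lemma \<rho>_pow:
  assumes "g \<in> carrier F2" "\<rho> g = proj A"
  shows "\<rho> (g [^]\<^bsub>F2\<^esub> (k :: nat)) = proj (mpow A k)"
proof (induction k)
  case (Suc k)
  then show ?case
    using \<rho>_mult[OF assms(1) F2.nat_pow_closed[OF assms(1)] assms(2) Suc] F2.nat_pow_Suc2[OF assms(1), of k]
    by simp
qed (simp add: \<rho>_one)

text \<open>The sign of the representative can be chosen such that it is an inverse on the level of matrices.\<close>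

lemma \<rho>_inverse:
  assumes g: "g \<in> carrier F2" "\<rho> g = proj A" "\<bar>det A\<bar> = 1"
  obtains B where "\<rho> (inv\<^bsub>F2\<^esub> g) = proj B" "B ** A = mat 1" "\<bar>det B\<bar> = 1"
proof -
  obtain B where B: "\<bar>det B\<bar> = 1" "\<rho> (inv\<^bsub>F2\<^esub> g) = proj B"
    using representative[of "inv\<^bsub>F2\<^esub> g"] g(1) by auto
  have "proj (B ** A) = proj (mat 1)"
    using \<rho>_mult[of "inv\<^bsub>F2\<^esub> g" g B A] g B \<rho>_one by simp
  then have "B ** A = mat 1 \<or> B ** A = - mat 1"
    using B(1) g(3) by (intro proj_eqD) (simp_all add: det_mul abs_mult)
  then show ?thesis
  proof
    assume "B ** A = - mat 1"
    then have "(- B) ** A = mat 1" by (simp add: vec_eq_iff forall_2 matrix_matrix_2)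
    then show ?thesis using that[of "- B"] B by (simp add: proj_uminus det_uminus_2)
  qed (use that B in blast)
qed

abbreviation \<tau> :: "letter list \<Rightarrow> real" where
  "\<tau> g \<equiv> abs_trace (\<rho> g)"

lemma \<tau>_inverse:
  assumes "g \<in> carrier F2"
  shows "\<tau> (inv\<^bsub>F2\<^esub> g) = \<tau> g"
proof -
  obtain A where A: "\<bar>det A\<bar> = 1" "\<rho> g = proj A" by (rule representative[OF assms])
  obtain B where B: "\<rho> (inv\<^bsub>F2\<^esub> g) = proj B" "B ** A = mat 1" "\<bar>det B\<bar> = 1"
    by (rule \<rho>_inverse[OF assms A(2,1)])
  show ?thesis using A B left_inverse_det_trace[OF B(2) A(1)] by (simp add: abs_trace_proj)
qed

lemma conjugate_representatives:
  assumes g: "g \<in> carrier F2" and h: "h \<in> carrier F2"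
    and A: "\<rho> g = proj A" "\<bar>det A\<bar> = 1"
  obtains B where "\<rho> (inv\<^bsub>F2\<^esub> h \<otimes>\<^bsub>F2\<^esub> g \<otimes>\<^bsub>F2\<^esub> h) = proj B" "det B = det A" "trace B = trace A"
proof -
  obtain P where P: "\<bar>det P\<bar> = 1" "\<rho> h = proj P" by (rule representative[OF h])
  obtain Q where Q: "\<rho> (inv\<^bsub>F2\<^esub> h) = proj Q" "Q ** P = mat 1" "\<bar>det Q\<bar> = 1"
    by (rule \<rho>_inverse[OF h P(2,1)])
  have "\<rho> (inv\<^bsub>F2\<^esub> h \<otimes>\<^bsub>F2\<^esub> g \<otimes>\<^bsub>F2\<^esub> h) = proj (Q ** A ** P)"
    using g h by (intro \<rho>_mult P Q A) simp_all
  moreover have "det (Q ** A ** P) = det A"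
    using arg_cong[OF Q(2), of det] by (simp add: det_mul mult_ac)
  moreover have "trace (Q ** A ** P) = trace A"
  proof -
    have "P ** Q = mat 1" using Q(2) by (simp add: matrix_left_right_inverse)
    moreover have "trace (Q ** A ** P) = trace (P ** Q ** A)"
      using trace_mul_sym[of "Q ** A" P] by (simp add: matrix_mul_assoc)
    ultimately show ?thesis by simp
  qed
  ultimately show ?thesis using that by blast
qed

definition trace_sum :: "letter list \<Rightarrow> letter list \<Rightarrow> real" where
  "trace_sum g h = \<tau> g + \<tau> h + \<tau> (g \<otimes>\<^bsub>F2\<^esub> h)"

lemma trace_sum_rotate:
  assumes "g \<in> carrier F2" "h \<in> carrier F2"
  shows "trace_sum h (inv\<^bsub>F2\<^esub> h \<otimes>\<^bsub>F2\<^esub> inv\<^bsub>F2\<^esub> g) = trace_sum g h"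
proof -
  have "inv\<^bsub>F2\<^esub> h \<otimes>\<^bsub>F2\<^esub> inv\<^bsub>F2\<^esub> g = inv\<^bsub>F2\<^esub> (g \<otimes>\<^bsub>F2\<^esub> h)"
    using assms by (simp add: F2.inv_mult_group)
  then have "\<tau> (inv\<^bsub>F2\<^esub> h \<otimes>\<^bsub>F2\<^esub> inv\<^bsub>F2\<^esub> g) = \<tau> (g \<otimes>\<^bsub>F2\<^esub> h)" using assms \<tau>_inverse by simp
  moreover have "h \<otimes>\<^bsub>F2\<^esub> (inv\<^bsub>F2\<^esub> h \<otimes>\<^bsub>F2\<^esub> inv\<^bsub>F2\<^esub> g) = inv\<^bsub>F2\<^esub> g" using assms by (simp add: F2.cancel_inv)
  ultimately show ?thesis using assms by (simp add: trace_sum_def \<tau>_inverse)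
qed

definition minimal_basis :: "letter list \<Rightarrow> letter list \<Rightarrow> bool" where
  "minimal_basis g h \<longleftrightarrow> basis_pair g h \<and> (\<forall>g' h'. basis_pair g' h' \<longrightarrow> trace_sum g h \<le> trace_sum g' h')"

lemma minimal_basis_rotate:
  assumes "minimal_basis g h"
  shows "minimal_basis h (inv\<^bsub>F2\<^esub> h \<otimes>\<^bsub>F2\<^esub> inv\<^bsub>F2\<^esub> g)"
  using assms basis_pair_rotate[of g h] trace_sum_rotate[of g h]
  by (simp add: minimal_basis_def basis_pair_def)

text \<open>Replacing \<open>g\<close> by its inverse only changes the third trace, from that of \<open>A' B\<close> to that of \<open>A B\<close>,
  where \<open>A\<close> represents the inverse of \<open>g\<close> and \<open>A'\<close> is the inverse matrix. By the trace identity the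
  two traces have the positive sum \<open>tr A tr B\<close>, up to the sign \<open>det A\<close>, so minimality says that
  \<open>tr(A B)\<close> is at least half of this sum. If both matrices reverse the orientation, then \<open>A' B\<close> is a
  hyperbolic matrix of determinant \<open>1\<close>, and minimality passes its trace bound on to \<open>A B\<close>.\<close>

lemma minimal_basis_contracting:
  assumes min: "minimal_basis g h"
    and lox: "\<And>x A. primitive F2 x \<Longrightarrow> \<rho> x = proj A \<Longrightarrow> \<bar>det A\<bar> = 1 \<Longrightarrow> loxodromic A"
  shows "contracting_pair (\<rho> (inv\<^bsub>F2\<^esub> g)) (\<rho> h)"
proof -
  have bp: "basis_pair g h" using min by (simp add: minimal_basis_def)
  then have gh: "g \<in> carrier F2" "h \<in> carrier F2" by (simp_all add: basis_pair_def)
  have bp': "basis_pair (inv\<^bsub>F2\<^esub> g) h" "basis_pair g (g \<otimes>\<^bsub>F2\<^esub> h)"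
    using basis_pair_inverse[OF bp] basis_pair_mult[OF bp] .
  obtain A0 where A0: "\<bar>det A0\<bar> = 1" "\<rho> (inv\<^bsub>F2\<^esub> g) = proj A0"
    by (rule representative[OF F2.inv_closed[OF gh(1)]])
  obtain B0 where B0: "\<bar>det B0\<bar> = 1" "\<rho> h = proj B0" by (rule representative[OF gh(2)])
  have "loxodromic A0" "loxodromic B0"
    using lox[OF basis_pair_primitive(1)[OF bp'(1)] A0(2,1)] lox[OF basis_pair_primitive(2)[OF bp] B0(2,1)]
    by simp_all
  note lox0 = this
  obtain A where A: "proj A = proj A0" "det A = det A0" "trace A > 0" "det A = 1 \<Longrightarrow> trace A > 2"
    using positive_trace_representative[OF A0(1) lox0(1)] by blast
  obtain B where B: "proj B = proj B0" "det B = det B0" "trace B > 0" "det B = 1 \<Longrightarrow> trace B > 2"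
    using positive_trace_representative[OF B0(1) lox0(2)] by blast
  have \<rho>A: "\<rho> (inv\<^bsub>F2\<^esub> g) = proj A" "\<bar>det A\<bar> = 1" and \<rho>B: "\<rho> h = proj B" "\<bar>det B\<bar> = 1"
    using A B A0 B0 by simp_all
  obtain A' where A': "\<rho> g = proj A'" "A' ** A = mat 1" "\<bar>det A'\<bar> = 1"
    using \<rho>_inverse[OF F2.inv_closed[OF gh(1)] \<rho>A] F2.inv_inv[OF gh(1)] by metis
  have AB: "\<rho> (inv\<^bsub>F2\<^esub> g \<otimes>\<^bsub>F2\<^esub> h) = proj (A ** B)" "\<rho> (g \<otimes>\<^bsub>F2\<^esub> h) = proj (A' ** B)"
    using gh by (intro \<rho>_mult \<rho>A \<rho>B A'; simp)+
  have dets: "\<bar>det (A ** B)\<bar> = 1" "\<bar>det (A' ** B)\<bar> = 1"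
    using \<rho>A(2) \<rho>B(2) A'(3) by (simp_all add: det_mul abs_mult)
  have "trace_sum g h \<le> trace_sum (inv\<^bsub>F2\<^esub> g) h" using min bp'(1) by (simp add: minimal_basis_def)
  then have ge: "\<bar>trace (A' ** B)\<bar> \<le> \<bar>trace (A ** B)\<bar>"
    using gh by (simp add: trace_sum_def \<tau>_inverse AB abs_trace_proj dets)
  have "trace (A ** B) + det A * trace (A' ** B) = trace A * trace B" by (rule trace_mult_inverse[OF A'(2)])
  moreover have "det A * trace (A' ** B) \<le> \<bar>trace (A' ** B)\<bar>"
    using \<rho>A(2) by (metis abs_ge_self abs_mult mult_1)
  moreover have pos: "trace A * trace B > 0" using A(3) B(3) by simp
  ultimately have ineq: "2 * trace (A ** B) \<ge> trace A * trace B" using ge by linarith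
  have "trace (A ** B) > 2" if "det A = -1" "det B = -1"
  proof -
    have "det (A' ** B) = 1"
      using left_inverse_det_trace(1)[OF A'(2) \<rho>A(2)] that by (simp add: det_mul)
    moreover have "loxodromic (A' ** B)"
      by (rule lox[OF basis_pair_primitive(2)[OF bp'(2)] AB(2) dets(2)])
    ultimately have "\<bar>trace (A' ** B)\<bar> > 2" by (simp add: loxodromic_def)
    then show ?thesis using ge ineq pos by linarith
  qed
  then have "common_cone A B"
    using common_cone_criterion[OF \<rho>A(2) \<rho>B(2) A(3) B(3) A(4) B(4) ineq] by blast
  moreover have "invertible A" "invertible B" using \<rho>A(2) \<rho>B(2) by (auto simp: invertible_det_nz)
  ultimately show ?thesis unfolding contracting_pair_def common_cone_def \<rho>A(1) \<rho>B(1) by blast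
qed

lemma contracting_pair_\<rho>_inverse:
  assumes "contracting_pair (\<rho> g) (\<rho> h)" "g \<in> carrier F2" "h \<in> carrier F2"
  shows "contracting_pair (\<rho> (inv\<^bsub>F2\<^esub> g)) (\<rho> (inv\<^bsub>F2\<^esub> h))"
proof -
  obtain A where A: "\<bar>det A\<bar> = 1" "\<rho> g = proj A" by (rule representative[OF assms(2)])
  obtain B where B: "\<bar>det B\<bar> = 1" "\<rho> h = proj B" by (rule representative[OF assms(3)])
  obtain A' where A': "\<rho> (inv\<^bsub>F2\<^esub> g) = proj A'" "A' ** A = mat 1" by (rule \<rho>_inverse[OF assms(2) A(2,1)])
  obtain B' where B': "\<rho> (inv\<^bsub>F2\<^esub> h) = proj B'" "B' ** B = mat 1" by (rule \<rho>_inverse[OF assms(3) B(2,1)])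
  have "invertible A" "invertible B" using A(1) B(1) by (auto simp: invertible_det_nz)
  then show ?thesis
    using contracting_pair_inverse[OF _ _ _ A'(2) B'(2)] assms(1) unfolding A(2) B(2) A'(1) B'(1) by blast
qed

lemma minimal_basis_weakly_positive:
  assumes min: "minimal_basis g h"
    and lox: "\<And>x A. primitive F2 x \<Longrightarrow> \<rho> x = proj A \<Longrightarrow> \<bar>det A\<bar> = 1 \<Longrightarrow> loxodromic A"
  shows "weakly_positive (R3 g h) Lambda3 \<rho>"
proof -
  have gh: "g \<in> carrier F2" "h \<in> carrier F2" using min by (simp_all add: minimal_basis_def basis_pair_def)
  define x where "x = idx_gen g h"
  have x: "x i \<in> carrier F2" for i using gh by (cases i) (simp_all add: x_def)
  have "minimal_basis (x i) (x (idx_next i))" for i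
  proof -
    note m = min minimal_basis_rotate[OF min] minimal_basis_rotate[OF minimal_basis_rotate[OF min]]
    have "inv\<^bsub>F2\<^esub> (inv\<^bsub>F2\<^esub> h \<otimes>\<^bsub>F2\<^esub> inv\<^bsub>F2\<^esub> g) \<otimes>\<^bsub>F2\<^esub> inv\<^bsub>F2\<^esub> h = g"
      using gh by (simp add: F2.inv_mult_group F2.m_assoc)
    with m show ?thesis by (cases i) (simp_all add: x_def)
  qed
  then have cp: "contracting_pair (\<rho> (inv\<^bsub>F2\<^esub> (x i))) (\<rho> (x (idx_next i)))" for i
    using minimal_basis_contracting lox by blast
  have "admissible Lambda3 (\<rho> \<circ> R3 g h)"
  proof (rule admissible_Lambda3I)
    fix i
    show "contracting_pair ((\<rho> \<circ> R3 g h) (v i)) ((\<rho> \<circ> R3 g h) (w i))"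
      using cp[of i] by (simp add: x_def)
    show "contracting_pair ((\<rho> \<circ> R3 g h) (v' i)) ((\<rho> \<circ> R3 g h) (w' i))"
      using contracting_pair_\<rho>_inverse[OF cp[of i]] x by (simp add: x_def)
  qed
  then show ?thesis by (simp add: weakly_positive_def)
qed

text \<open>Below the value of one given basis, there are only finitely many possible values of the sum.\<close>

lemma minimal_basis_exists:
  assumes fin: "\<And>t. finite {\<tau> x | x. primitive F2 x \<and> \<tau> x \<le> t}"
  obtains g h where "minimal_basis g h"
proof -
  obtain a b where ab: "basis_pair a b" using basis_pair_letters by blast
  define t where "t = trace_sum a b"
  define D where "D = {\<tau> x | x. primitive F2 x \<and> \<tau> x \<le> t}"
  define V where "V = {trace_sum g h | g h. basis_pair g h \<and> trace_sum g h \<le> t}"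
  have nonneg: "\<tau> x \<ge> 0" for x by (simp add: abs_trace_def)
  have "V \<subseteq> (\<lambda>(p, q, r). p + q + r) ` (D \<times> D \<times> D)"
  proof
    fix s assume "s \<in> V"
    then obtain g h where gh: "basis_pair g h" "s = trace_sum g h" "s \<le> t" by (auto simp: V_def)
    have "primitive F2 g" "primitive F2 h" "primitive F2 (g \<otimes>\<^bsub>F2\<^esub> h)"
      using basis_pair_primitive gh(1) basis_pair_mult by blast+
    moreover have "\<tau> g \<le> t" "\<tau> h \<le> t" "\<tau> (g \<otimes>\<^bsub>F2\<^esub> h) \<le> t"
      using gh(2,3) nonneg[of g] nonneg[of h] nonneg[of "g \<otimes>\<^bsub>F2\<^esub> h"] unfolding trace_sum_def by linarith+
    ultimately have "(\<tau> g, \<tau> h, \<tau> (g \<otimes>\<^bsub>F2\<^esub> h)) \<in> D \<times> D \<times> D" by (auto simp: D_def)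
    then show "s \<in> (\<lambda>(p, q, r). p + q + r) ` (D \<times> D \<times> D)"
      unfolding gh(2) trace_sum_def by (rule rev_image_eqI) simp
  qed
  moreover have "finite D" unfolding D_def by (rule fin)
  ultimately have finV: "finite V" by (simp add: finite_subset)
  have "t \<in> V" using ab by (auto simp: V_def t_def)
  then have "Min V \<in> V" using finV Min_in by blast
  then obtain g h where gh: "basis_pair g h" "Min V = trace_sum g h" "trace_sum g h \<le> t"
    by (auto simp: V_def)
  have "trace_sum g h \<le> trace_sum g' h'" if "basis_pair g' h'" for g' h'
  proof (cases "trace_sum g' h' \<le> t")
    case True
    then have "trace_sum g' h' \<in> V" using that by (auto simp: V_def)
    then show ?thesis using gh(2) finV Min_le by metis
  qed (use gh(3) in linarith)
  then show ?thesis using that gh(1) unfolding minimal_basis_def by blast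
qed

text \<open>The element \<open>c\<close> is the conjugate whose powers lie on a rooted primitive ray. Its word length is
  bounded by its trace, and traces do not see the conjugation.\<close>

lemma primitive_stable_conjugate:
  assumes ip: "inner_product ip" and
    axes: "\<forall>\<gamma>. primitive F2 \<gamma> \<longrightarrow> (\<exists>\<xi>. is_axis F2 S \<gamma> \<xi>)" and
    "\<kappa> > 0" and
    growth: "\<forall>\<eta>. primitive_ray F2 S \<eta> \<and> \<eta> 0 = \<one>\<^bsub>F2\<^esub> \<longrightarrow>
      (\<forall>i. alpha_mu ip (\<rho> (\<eta> i)) \<ge> \<kappa> * real i - \<kappa>')" and
    g: "primitive F2 g" "\<rho> g = proj A" "\<bar>det A\<bar> = 1"
  shows "loxodromic A" "\<exists>c \<in> carrier F2. \<tau> c = \<tau> g \<and> \<kappa> * real (word_length F2 S c) \<le> 2 * ln (1 + \<tau> g)"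
proof -
  have gc: "g \<in> carrier F2" using g(1) by (auto simp: primitive_def)
  obtain \<xi> where axis: "is_axis F2 S g \<xi>" using axes g(1) by blast
  obtain h m \<eta> where h: "h \<in> carrier F2" and m: "m \<ge> 1" and ray: "primitive_ray F2 S \<eta>" "\<eta> 0 = \<one>\<^bsub>F2\<^esub>" and
    len: "word_length F2 S (inv\<^bsub>F2\<^esub> h \<otimes>\<^bsub>F2\<^esub> g \<otimes>\<^bsub>F2\<^esub> h) = m" and
    pow: "\<And>k. \<eta> (m * k) = (inv\<^bsub>F2\<^esub> h \<otimes>\<^bsub>F2\<^esub> g \<otimes>\<^bsub>F2\<^esub> h) [^]\<^bsub>F2\<^esub> (k :: nat)"
    using F2.axis_rooted_ray[OF g(1) axis] F2_no_involution[OF gc] by metis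
  define c where "c = inv\<^bsub>F2\<^esub> h \<otimes>\<^bsub>F2\<^esub> g \<otimes>\<^bsub>F2\<^esub> h"
  have c: "c \<in> carrier F2" using gc h by (simp add: c_def)
  obtain B where B: "\<rho> c = proj B" "det B = det A" "trace B = trace A"
    unfolding c_def by (rule conjugate_representatives[OF gc h g(2,3)])
  have dB: "\<bar>det B\<bar> = 1" using B g by simp
  have "alpha_mu ip (proj (mpow B k)) \<ge> (\<kappa> * real m) * real k - \<kappa>'" for k
    using growth[rule_format, OF conjI[OF ray], of "m * k"] \<rho>_pow[OF c B(1), of k] unfolding pow c_def[symmetric] by (simp add: mult_ac)
  then have "loxodromic B" "\<kappa> * real m \<le> 2 * ln (1 + \<bar>trace B\<bar>)"
    using growth_trace[OF ip dB, of "\<kappa> * real m" \<kappa>'] \<open>\<kappa> > 0\<close> m by simp_all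
  moreover have \<tau>: "\<tau> c = \<tau> g" "\<tau> g = \<bar>trace B\<bar>" using B g dB by (simp_all add: abs_trace_proj)
  ultimately have "loxodromic A" "\<kappa> * real (word_length F2 S c) \<le> 2 * ln (1 + \<tau> g)"
    using B len by (simp_all add: loxodromic_def c_def)
  then show "loxodromic A" "\<exists>c \<in> carrier F2. \<tau> c = \<tau> g \<and> \<kappa> * real (word_length F2 S c) \<le> 2 * ln (1 + \<tau> g)"
    using c \<tau>(1) by blast+
qed

end

section \<open>Weak positivity\<close>

theorem theoremA1:
  fixes ip :: "real^2 \<Rightarrow> real^2 \<Rightarrow> real"
    and \<rho> :: "letter list \<Rightarrow> (real^2^2) set"
  assumes "inner_product ip"
    and "\<rho> \<in> hom F2 PGL2"
    and "primitive_stable ip \<rho>"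
  shows "\<exists>\<gamma>1 \<in> carrier F2. \<exists>\<gamma>2 \<in> carrier F2.
           generate F2 {\<gamma>1, \<gamma>2} = carrier F2 \<and>
           weakly_positive (R3 \<gamma>1 \<gamma>2) Lambda3 \<rho>"
proof -
  interpret pgl_representation \<rho> by unfold_locales (rule assms(2))
  obtain S \<kappa> \<kappa>' where S: "finite S" "S \<subseteq> carrier F2" "generate F2 S = carrier F2" and
    axes: "\<forall>\<gamma>. primitive F2 \<gamma> \<longrightarrow> (\<exists>\<xi>. is_axis F2 S \<gamma> \<xi>)" and \<kappa>: "\<kappa> > 0" and
    growth: "\<forall>\<eta>. primitive_ray F2 S \<eta> \<and> \<eta> 0 = \<one>\<^bsub>F2\<^esub> \<longrightarrow>
      (\<forall>i. alpha_mu ip (\<rho> (\<eta> i)) \<ge> \<kappa> * real i - \<kappa>')"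
    using assms(3) unfolding primitive_stable_def by blast
  note conj = primitive_stable_conjugate[OF assms(1) axes \<kappa> growth]
  have "finite {\<tau> x | x. primitive F2 x \<and> \<tau> x \<le> t}" for t
  proof (rule finite_subset)
    define N where "N = nat \<lfloor>2 * ln (1 + t) / \<kappa>\<rfloor>"
    show "finite (\<tau> ` {c \<in> carrier F2. word_length F2 S c \<le> N})"
      using F2.finite_word_ball[OF S] by simp
    show "{\<tau> x | x. primitive F2 x \<and> \<tau> x \<le> t} \<subseteq> \<tau> ` {c \<in> carrier F2. word_length F2 S c \<le> N}"
    proof
      fix s assume "s \<in> {\<tau> x | x. primitive F2 x \<and> \<tau> x \<le> t}"
      then obtain x where x: "primitive F2 x" "\<tau> x \<le> t" "s = \<tau> x" by blast
      then obtain A where A: "\<bar>det A\<bar> = 1" "\<rho> x = proj A"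
        using representative by (auto simp: primitive_def)
      obtain c where c: "c \<in> carrier F2" "\<tau> c = \<tau> x" "\<kappa> * real (word_length F2 S c) \<le> 2 * ln (1 + \<tau> x)"
        using conj(2)[OF x(1) A(2,1)] by blast
      have "\<tau> x \<ge> 0" by (simp add: abs_trace_def)
      then have "ln (1 + \<tau> x) \<le> ln (1 + t)" using x(2) by (intro ln_mono) auto
      then have "real (word_length F2 S c) \<le> 2 * ln (1 + t) / \<kappa>"
        using c(3) \<kappa> by (simp add: pos_le_divide_eq mult.commute)
      then have "word_length F2 S c \<le> N" unfolding N_def by linarith
      then show "s \<in> \<tau> ` {c \<in> carrier F2. word_length F2 S c \<le> N}" unfolding x(3)
        using c by (intro rev_image_eqI[of c]) simp_all
    qed
  qed
  then obtain g h where gh: "minimal_basis g h" using minimal_basis_exists by metis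
  moreover have "loxodromic A" if "primitive F2 x" "\<rho> x = proj A" "\<bar>det A\<bar> = 1" for x A
    by (rule conj(1)[OF that])
  ultimately have "weakly_positive (R3 g h) Lambda3 \<rho>" by (rule minimal_basis_weakly_positive)
  then show ?thesis using gh unfolding minimal_basis_def basis_pair_def by blast
qed

end
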